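(* Let $n\ge 1$ users share a slotted channel towards a common sink, each user independently generating a time-stamped update in each slot with probability $\pi_a\in(0,1]$, and let the users access the channel with the irregular repetition slotted ALOHA (IRSA) scheme with frames of $m\ge 1$ slots and repetition distribution $\Lambda$, as described in the context. Let $S$ be the aggregate throughput of the scheme, i.e. the average number of updates decoded at the sink per slot, and suppose $S>0$. Then, almost surely, the average network age of information of IRSA, expressed in slots, is $$ \Delta_{\mathrm{irsa}} \;=\; \frac{m}{2} + \frac{n}{S} + \left( \frac{1}{\pi_a} - \frac{m(1-\pi_a)^{m}}{1-(1-\pi_a)^{m}} \right). $$
   Context: **Time and traffic.** Time is continuous, $t\ge 0$, and divided into slots of unit duration; slot $s\in\{1,2,\dots\}$ is the interval $[s-1,s)$ and fits one packet. There are $n$ users, all synchronised to the slots. In every slot each user becomes active with probability $\pi_a$, independently across users and slots. A user becoming active in slot $s$ generates, at the beginning of that slot, a status update with time-stamp $s-1$. **IRSA access.** Slots are grouped in consecutive frames of $m$ slots, frame $f\in\{1,2,\dots\}$ consisting of slots $(f-1)m+1,\dots,fm$; all users are frame-synchronised. A user that became active at least once during frame $f$ transmits, during frame $f+1$, only the last update it generated during frame $f$ (all other updates are discarded); a user that was not active during frame $f$ does not transmit in frame $f+1$. Each transmitting user independently draws a number $\ell$ of replicas, with $\ell$ taking the value $\ell$ with probability $\Lambda_\ell$, where $\Lambda(x)=\sum_{\ell=1}^{L}\Lambda_\ell x^\ell$ is a fixed probability distribution ($L\le m$), and places its $\ell$ replicas in $\ell$ distinct slots of the frame chosen uniformly at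 random. The draws are independent across users and frames and independent of the activation process. All replicas carry the time-stamp of the transmitted update. There is no feedback and no retransmission. **Decoding.** The channel is a collision channel: a slot containing exactly one (remaining) packet is decoded, and no information is obtained from a slot containing two or more. At the end of each frame the sink performs successive interference cancellation: whenever some slot of the frame contains exactly one remaining packet, the corresponding user's update is decoded and all replicas of that user are removed from the frame; this is iterated until all users are decoded or no slot with exactly one packet remains. Processing time is negligible, so all updates decoded from a frame are received by the sink exactly at the end of that frame. **Throughput.** $S$ is the average number of updates decoded per slot: $S=\frac1m\,\mathbb{E}[D]$, where $D$ is the number of users decoded in a generic frame $f\ge 2$. Equivalently $S=(1-p_l)G$, where $G=n\,(1-(1-\pi_a)^m)/m$ is the average number of transmitting users per slot and $p_l$ is the probability that a transmitted update is not decoded. **Age of information.** For user $i$, let $Y^{(i)}(t)$ be the time-stamp of the last update from user $i$ received by the sink as of time $t$ (before the first reception $Y^{(i)}(t)$ equals an arbitrary fixed finite initial value, e.g. $0$). The current age is $\delta^{(i)}(t)=t-Y^{(i)}(t)$, the average age of user $i$ is $$\Delta^{(i)}=\lim_{\tau\to\infty}\frac1\tau\int_0^\tau \delta^{(i)}(t)\,dt,$$ and the average network age of information is $\Delta=\frac1n\sum_{i=1}^n\Delta^{(i)}$; $\Delta_{\mathrm{irsa}}$ denotes $\Delta$ for the IRSA scheme. *)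

theory Defs
  imports "HOL-Probability.Probability"
begin

text \<open>
  Users are \<open>1, ..., n\<close>; slot \<open>s \<ge> 1\<close> is the time interval \<open>[s - 1, s)\<close>. The sample path of the system
  is given by the activity \<open>a i s\<close> (user \<open>i\<close> becomes active in slot \<open>s\<close>) and by the placement \<open>c i f\<close>,
  the set of positions in \<open>{1..m}\<close> within frame \<open>f\<close> in which user \<open>i\<close> puts its replicas if it
  transmits in that frame.
\<close>

type_synonym activity = "nat \<Rightarrow> nat \<Rightarrow> bool"
type_synonym placement = "nat \<Rightarrow> nat \<Rightarrow> nat set"

definition frame_slots :: "nat \<Rightarrow> nat \<Rightarrow> nat set" where
  "frame_slots m f = {(f - 1) * m + 1..f * m}"

definition transmitters :: "nat \<Rightarrow> nat \<Rightarrow> activity \<Rightarrow> nat \<Rightarrow> nat set" where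
  "transmitters n m a f = {i \<in> {1..n}. f \<ge> 2 \<and> (\<exists>s\<in>frame_slots m (f - 1). a i s)}"

text \<open>Time-stamp of the update transmitted by user \<open>i\<close> in frame \<open>f\<close>; only meaningful if \<open>i\<close> transmits.\<close>

definition time_stamp :: "nat \<Rightarrow> activity \<Rightarrow> nat \<Rightarrow> nat \<Rightarrow> real" where
  "time_stamp m a i f = real (Max {s \<in> frame_slots m (f - 1). a i s}) - 1"

text \<open>
  One step of successive interference cancellation on the set \<open>Q\<close> of remaining users, \<open>r i\<close> being the
  set of slots that hold the replicas of user \<open>i\<close>. The order of the steps is left open; the lemma
  below shows that it does not affect the set of decoded users.
\<close>

inductive sic_step :: "(nat \<Rightarrow> nat set) \<Rightarrow> nat set \<Rightarrow> nat set \<Rightarrow> bool" for r where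
  "{j \<in> Q. k \<in> r j} = {i} \<Longrightarrow> sic_step r Q (Q - {i})"

definition sic_decoded :: "(nat \<Rightarrow> nat set) \<Rightarrow> nat set \<Rightarrow> nat set" where
  "sic_decoded r U = {i \<in> U. \<exists>Q. (sic_step r)\<^sup>*\<^sup>* U Q \<and> i \<notin> Q}"

lemma sic_decoded_terminal:
  assumes "(sic_step r)\<^sup>*\<^sup>* U R" and "\<nexists>Q. sic_step r R Q"
  shows "sic_decoded r U = U - R"
proof -
  have sub: "Q \<subseteq> U" if "(sic_step r)\<^sup>*\<^sup>* U Q" for Q
    using that by (induction rule: rtranclp_induct) (auto elim!: sic_step.cases)
  have "R \<subseteq> Q" if "(sic_step r)\<^sup>*\<^sup>* U Q" for Q
    using that
  proof (induction rule: rtranclp_induct)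
    case base
    show ?case using sub[OF assms(1)] .
  next
    case (step P Q)
    from \<open>sic_step r P Q\<close> obtain k i where k: "{j \<in> P. k \<in> r j} = {i}" "Q = P - {i}"
      by (auto elim: sic_step.cases)
    have "i \<notin> R"
    proof
      assume "i \<in> R"
      with k(1) \<open>R \<subseteq> P\<close> have "{j \<in> R. k \<in> r j} = {i}" by blast
      with assms(2) show False by (blast intro: sic_step.intros)
    qed
    with k(2) \<open>R \<subseteq> P\<close> show ?case by blast
  qed
  with assms(1) show ?thesis unfolding sic_decoded_def by blast
qed

definition decoded :: "nat \<Rightarrow> nat \<Rightarrow> activity \<Rightarrow> placement \<Rightarrow> nat \<Rightarrow> nat set" where
  "decoded n m a c f = sic_decoded (\<lambda>i. c i f) (transmitters n m a f)"

text \<open>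
  Updates decoded from frame \<open>f\<close> are received at its end, that is at time \<open>f * m\<close>. The initial value
  before the first reception from user \<open>i\<close> is \<open>y0 i\<close>.
\<close>

definition reception_frames :: "nat \<Rightarrow> nat \<Rightarrow> activity \<Rightarrow> placement \<Rightarrow> nat \<Rightarrow> real \<Rightarrow> nat set" where
  "reception_frames n m a c i t = {f. i \<in> decoded n m a c f \<and> real (f * m) \<le> t}"

definition last_stamp ::
  "nat \<Rightarrow> nat \<Rightarrow> (nat \<Rightarrow> real) \<Rightarrow> activity \<Rightarrow> placement \<Rightarrow> nat \<Rightarrow> real \<Rightarrow> real" where
  "last_stamp n m y0 a c i t =
     (if reception_frames n m a c i t = {} then y0 i
      else time_stamp m a i (Max (reception_frames n m a c i t)))"

definition age ::
  "nat \<Rightarrow> nat \<Rightarrow> (nat \<Rightarrow> real) \<Rightarrow> activity \<Rightarrow> placement \<Rightarrow> nat \<Rightarrow> real \<Rightarrow> real" where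
  "age n m y0 a c i t = t - last_stamp n m y0 a c i t"

definition mean_age_upto ::
  "nat \<Rightarrow> nat \<Rightarrow> (nat \<Rightarrow> real) \<Rightarrow> activity \<Rightarrow> placement \<Rightarrow> nat \<Rightarrow> real \<Rightarrow> real" where
  "mean_age_upto n m y0 a c i \<tau> = 1 / \<tau> * integral {0..\<tau>} (age n m y0 a c i)"

text \<open>\<open>Lim\<close> is unspecified if there is no limit, so existence has to be asserted separately.\<close>

definition average_age ::
  "nat \<Rightarrow> nat \<Rightarrow> (nat \<Rightarrow> real) \<Rightarrow> activity \<Rightarrow> placement \<Rightarrow> nat \<Rightarrow> real" where
  "average_age n m y0 a c i = Lim at_top (mean_age_upto n m y0 a c i)"

definition network_age ::
  "nat \<Rightarrow> nat \<Rightarrow> (nat \<Rightarrow> real) \<Rightarrow> activity \<Rightarrow> placement \<Rightarrow> real" where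
  "network_age n m y0 a c = 1 / real n * (\<Sum>i=1..n. average_age n m y0 a c i)"

text \<open>Law of the positions of the replicas: their number has law \<open>\<Lambda>\<close>, then uniform given the number.\<close>

definition placement_pmf :: "nat \<Rightarrow> nat pmf \<Rightarrow> nat set pmf" where
  "placement_pmf m \<Lambda> = bind_pmf \<Lambda> (\<lambda>l. pmf_of_set {T. T \<subseteq> {1..m} \<and> card T = l})"

text \<open>
  The placement is drawn for every user and every frame; the draws of users that do not transmit
  are never used. Since activities and placements have different value types, the mutual
  independence of all of them is stated with \<open>indep_sets\<close> for the generated sigma-algebras; an index
  \<open>Inl (i, s)\<close> stands for the activity of user \<open>i\<close> in slot \<open>s\<close>, and \<open>Inr (i, f)\<close> for the placement
  of user \<open>i\<close> in frame \<open>f\<close>.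
\<close>

locale irsa = prob_space M
  for M :: "'w measure" +
  fixes n m L :: nat and \<pi>\<^sub>a :: real and \<Lambda> :: "nat pmf"
    and A :: "'w \<Rightarrow> activity" and C :: "'w \<Rightarrow> placement"
  assumes n_ge_1: "n \<ge> 1" and m_ge_1: "m \<ge> 1"
    and act_prob: "0 < \<pi>\<^sub>a" "\<pi>\<^sub>a \<le> 1"
    and L_le_m: "L \<le> m" and degree_support: "set_pmf \<Lambda> \<subseteq> {1..L}"
    and indep:
      "indep_sets
         (\<lambda>x. case x of
            Inl (i, s) \<Rightarrow> {(\<lambda>\<omega>. A \<omega> i s) -` B \<inter> space M | B. B \<in> sets (count_space UNIV)}
          | Inr (i, f) \<Rightarrow> {(\<lambda>\<omega>. C \<omega> i f) -` B \<inter> space M | B. B \<in> sets (count_space UNIV)})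
         (({1..n} \<times> {1..}) <+> ({1..n} \<times> {1..}))"
    and activity_distr:
      "\<And>i s. i \<in> {1..n} \<Longrightarrow> s \<ge> 1 \<Longrightarrow>
         distr M (count_space UNIV) (\<lambda>\<omega>. A \<omega> i s) = measure_pmf (bernoulli_pmf \<pi>\<^sub>a)"
    and placement_distr:
      "\<And>i f. i \<in> {1..n} \<Longrightarrow> f \<ge> 1 \<Longrightarrow>
         distr M (count_space UNIV) (\<lambda>\<omega>. C \<omega> i f) = measure_pmf (placement_pmf m \<Lambda>)"

text \<open>Expected number of users decoded in frame \<open>f\<close>, per slot; the steady regime is \<open>f \<ge> 2\<close>.\<close>

definition throughput ::
  "'w measure \<Rightarrow> nat \<Rightarrow> nat \<Rightarrow> ('w \<Rightarrow> activity) \<Rightarrow> ('w \<Rightarrow> placement) \<Rightarrow> nat \<Rightarrow> real" where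
  "throughput M n m A C f = 1 / real m * (\<integral>\<omega>. real (card (decoded n m (A \<omega>) (C \<omega>) f)) \<partial>M)"

end

theory Submission
  imports Defs "HOL-Library.Discrete_Functions"
begin

text \<open>
  Fix a user and let \<open>Y\<^sub>k\<close> be its age at the end of frame \<open>k + 1\<close>. Within a frame the age grows with
  slope one, so the average age is the Cesaro limit of \<open>Y\<^sub>k\<close> plus \<open>m / 2\<close>. Moreover \<open>Y\<^sub>k\<close> obeys an affine
  recursion \<open>Y\<^sub>k\<^sub>+\<^sub>1 = a\<^sub>k Y\<^sub>k + g\<^sub>k\<close>: if the user is decoded, then \<open>a\<^sub>k = 0\<close> and \<open>g\<^sub>k\<close> is the age of the
  received update; otherwise \<open>a\<^sub>k = 1\<close> and \<open>g\<^sub>k = m\<close>. The pairs \<open>(a\<^sub>k, g\<^sub>k)\<close> are independent and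
  identically distributed, so \<open>Z\<^sub>k = Y\<^sub>k\<^sub>+\<^sub>1 - E[a] Y\<^sub>k - E[g]\<close> is an orthogonal sequence bounded in
  \<open>L\<^sup>2\<close>, and the strong law for such sequences yields the limit \<open>E[g] / (1 - E[a])\<close>.

  By symmetry every user is decoded with the same probability \<open>p = m S / n\<close>. Whether an active user
  is decoded does not depend on the slot of its last activity, so the mean age of a received
  update follows from a truncated geometric law.
\<close>

section \<open>A strong law for orthogonal sequences\<close>

text \<open>Since 1 / (k + 1)^2 is summable, the series of the scaled variables has finite
  expectation. It is therefore finite almost surely, and its terms tend to 0.\<close>

lemma (in prob_space) AE_scaled_tendsto_0:
  fixes Q :: "nat \<Rightarrow> 'a \<Rightarrow> real"
  assumes int: "\<And>k. integrable M (Q k)" and nonneg: "\<And>k \<omega>. 0 \<le> Q k \<omega>"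
    and bound: "\<And>k. expectation (Q k) \<le> c"
  shows "AE \<omega> in M. (\<lambda>k. Q k \<omega> / real (Suc k) ^ 2) \<longlonglongrightarrow> 0"
proof -
  have [measurable]: "Q k \<in> borel_measurable M" for k
    using int by auto
  have c: "0 \<le> c"
    using order_trans[OF Bochner_Integration.integral_nonneg bound[of 0]] nonneg by auto
  have sq: "summable (\<lambda>k. 1 / real (Suc k) ^ 2)"
    using inverse_power_summable[of 2, where 'a=real] summable_Suc_iff[of "\<lambda>n. 1 / real n ^ 2"]
    by (simp add: field_simps)
  have "(\<integral>\<^sup>+\<omega>. (\<Sum>k. ennreal (Q k \<omega> / real (Suc k) ^ 2)) \<partial>M)
      = (\<Sum>k. \<integral>\<^sup>+\<omega>. ennreal (Q k \<omega> / real (Suc k) ^ 2) \<partial>M)"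
    by (rule nn_integral_suminf) measurable
  also have "\<dots> \<le> (\<Sum>k. ennreal (c * (1 / real (Suc k) ^ 2)))"
  proof (intro suminf_le summableI)
    fix k
    have "(\<integral>\<^sup>+\<omega>. ennreal (Q k \<omega> / real (Suc k) ^ 2) \<partial>M)
        = ennreal (expectation (\<lambda>\<omega>. Q k \<omega> / real (Suc k) ^ 2))"
      by (intro nn_integral_eq_integral) (use int nonneg in auto)
    also have "\<dots> \<le> ennreal (c * (1 / real (Suc k) ^ 2))"
      using bound[of k] by (intro ennreal_leI) (simp add: divide_right_mono)
    finally show "(\<integral>\<^sup>+\<omega>. ennreal (Q k \<omega> / real (Suc k) ^ 2) \<partial>M)
        \<le> ennreal (c * (1 / real (Suc k) ^ 2))" .
  qed
  also have "\<dots> < \<infinity>"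
    by (subst suminf_ennreal2) (use c summable_mult[OF sq, of c] in auto)
  finally have "AE \<omega> in M. (\<Sum>k. ennreal (Q k \<omega> / real (Suc k) ^ 2)) \<noteq> \<infinity>"
    by (intro nn_integral_PInf_AE) auto
  then show ?thesis
  proof eventually_elim
    case (elim \<omega>)
    then have "summable (\<lambda>k. Q k \<omega> / real (Suc k) ^ 2)"
      by (intro summable_suminf_not_top) (simp_all add: nonneg del: of_nat_Suc)
    then show ?case by (rule summable_LIMSEQ_zero)
  qed
qed

text \<open>Orthogonality bounds the second moment of a block sum by \<open>c\<close> times the
  block length. That suffices along the squares j^2; each K is then compared with the largest square
  not above it, from which fewer than 2 j + 1 terms separate it.\<close>

lemma (in prob_space) orthogonal_strong_law:
  fixes Z :: "nat \<Rightarrow> 'a \<Rightarrow> real"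
  assumes int: "\<And>k l. integrable M (\<lambda>\<omega>. Z k \<omega> * Z l \<omega>)"
    and orth: "\<And>k l. k < l \<Longrightarrow> expectation (\<lambda>\<omega>. Z k \<omega> * Z l \<omega>) = 0"
    and bound: "\<And>k. expectation (\<lambda>\<omega>. Z k \<omega> * Z k \<omega>) \<le> c"
  shows "AE \<omega> in M. (\<lambda>K. (\<Sum>k<K. Z k \<omega>) / real K) \<longlonglongrightarrow> 0"
proof -
  define T where "T a b \<omega> = (\<Sum>k=a..<b. Z k \<omega>)" for a b :: nat and \<omega>
  have c: "0 \<le> c"
    using order_trans[OF Bochner_Integration.integral_nonneg bound[of 0]] by auto
  have T2: "(T a b \<omega>)\<^sup>2 = (\<Sum>k=a..<b. \<Sum>l=a..<b. Z k \<omega> * Z l \<omega>)" for a b \<omega>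
    by (simp add: T_def power2_eq_square sum_product)
  have T2_int: "integrable M (\<lambda>\<omega>. (T a b \<omega>)\<^sup>2)" for a b
    unfolding T2 by (intro Bochner_Integration.integrable_sum int)
  have T2_exp: "expectation (\<lambda>\<omega>. (T a b \<omega>)\<^sup>2) \<le> c * (b - a)" for a b
  proof -
    have orth': "expectation (\<lambda>\<omega>. Z k \<omega> * Z l \<omega>) = 0" if "k \<noteq> l" for k l
      using that orth[of k l] orth[of l k] by (cases "k < l") (auto simp: mult.commute)
    have "expectation (\<lambda>\<omega>. (T a b \<omega>)\<^sup>2)
        = (\<Sum>k=a..<b. \<Sum>l=a..<b. expectation (\<lambda>\<omega>. Z k \<omega> * Z l \<omega>))"
      unfolding T2 by (simp add: Bochner_Integration.integral_sum int)
    also have "\<dots> = (\<Sum>k=a..<b. \<Sum>l=a..<b. if l = k then expectation (\<lambda>\<omega>. Z k \<omega> * Z k \<omega>) else 0)"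
      by (intro sum.cong refl) (auto simp: orth')
    also have "\<dots> = (\<Sum>k=a..<b. expectation (\<lambda>\<omega>. Z k \<omega> * Z k \<omega>))"
      by (intro sum.cong refl) simp
    also have "\<dots> \<le> (\<Sum>k=a..<b. c)"
      by (intro sum_mono bound)
    finally show ?thesis by (simp add: mult.commute)
  qed
  \<comment> \<open>\<open>W j\<close> controls the partial sums at \<open>j\<^sup>2\<close> and their deviation up to the next square; its
    expectation is bounded in \<open>j\<close>.\<close>
  define W where
    "W j \<omega> = ((T 0 (j\<^sup>2) \<omega>)\<^sup>2 + (\<Sum>K=j\<^sup>2..<(Suc j)\<^sup>2. (T (j\<^sup>2) K \<omega>)\<^sup>2)) / real (Suc j) ^ 2"
    for j \<omega>
  have "AE \<omega> in M. (\<lambda>j. W j \<omega> / real (Suc j) ^ 2) \<longlonglongrightarrow> 0"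
  \<comment> \<open>There are 2 j + 1 deviations, each of second moment at most c (2 j + 1), and j^2
    + (2 j + 1)^2 <= 5 (j + 1)^2.\<close>
  proof (rule AE_scaled_tendsto_0[where c = "5 * c"])
    fix j
    show "integrable M (W j)"
      unfolding W_def by (intro integrable_divide Bochner_Integration.integrable_add
        Bochner_Integration.integrable_sum T2_int)
    show "0 \<le> W j \<omega>" for \<omega>
      by (auto simp: W_def intro!: divide_nonneg_nonneg add_nonneg_nonneg sum_nonneg)
    have "expectation (W j) = (expectation (\<lambda>\<omega>. (T 0 (j\<^sup>2) \<omega>)\<^sup>2)
        + (\<Sum>K=j\<^sup>2..<(Suc j)\<^sup>2. expectation (\<lambda>\<omega>. (T (j\<^sup>2) K \<omega>)\<^sup>2))) / real (Suc j) ^ 2"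
      unfolding W_def
      by (simp add: Bochner_Integration.integral_add Bochner_Integration.integral_sum T2_int)
    also have "\<dots> \<le> (c * real (j\<^sup>2) + (\<Sum>K=j\<^sup>2..<(Suc j)\<^sup>2. c * real (2 * j + 1))) / real (Suc j) ^ 2"
    proof (intro divide_right_mono add_mono sum_mono)
      show "expectation (\<lambda>\<omega>. (T 0 (j\<^sup>2) \<omega>)\<^sup>2) \<le> c * real (j\<^sup>2)"
        using T2_exp[of 0 "j\<^sup>2"] by simp
      fix K assume "K \<in> {j\<^sup>2..<(Suc j)\<^sup>2}"
      then have "K - j\<^sup>2 \<le> 2 * j + 1" by (auto simp: power2_eq_square)
      then show "expectation (\<lambda>\<omega>. (T (j\<^sup>2) K \<omega>)\<^sup>2) \<le> c * real (2 * j + 1)"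
        using T2_exp[of "j\<^sup>2" K] c
        by (meson mult_left_mono of_nat_le_iff order_trans)
    qed simp
    also have "\<dots> = c * (real j ^ 2 + real (2 * j + 1) ^ 2) / real (Suc j) ^ 2"
      by (simp add: power2_eq_square algebra_simps)
    also have "\<dots> \<le> 5 * c"
    proof -
      have "real j ^ 2 + real (2 * j + 1) ^ 2 \<le> 5 * real (Suc j) ^ 2"
        by (simp add: power2_eq_square algebra_simps)
      then show ?thesis
        using mult_left_mono[OF _ c] by (simp add: divide_le_eq mult.assoc mult.left_commute)
    qed
    finally show "expectation (W j) \<le> 5 * c" .
  qed
  then show ?thesis
  proof eventually_elim
    case (elim \<omega>)
    \<comment> \<open>The factor 32 is 2 * 16: the 2 comes from (u + v)^2 <= 2 (u^2 + v^2), the 16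
      from (j + 1)^4 <= (2 j)^4 <= 16 K^2 with j = \<open>floor_sqrt K\<close> >= 1.\<close>
    have lim: "(\<lambda>K. 32 * (W (floor_sqrt K) \<omega> / real (Suc (floor_sqrt K)) ^ 2)) \<longlonglongrightarrow> 0"
    proof (rule tendsto_mult_right_zero, rule filterlim_compose[OF elim])
      show "filterlim floor_sqrt at_top at_top"
        unfolding filterlim_at_top
        by (metis eventually_at_top_linorder le_floor_sqrt_iff)
    qed
    have "(\<lambda>K. ((\<Sum>k<K. Z k \<omega>) / real K)\<^sup>2) \<longlonglongrightarrow> 0"
    proof (rule tendsto_sandwich[OF _ _ tendsto_const lim])
      show "\<forall>\<^sub>F K in sequentially. 0 \<le> ((\<Sum>k<K. Z k \<omega>) / real K)\<^sup>2"
        by simp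
      show "\<forall>\<^sub>F K in sequentially. ((\<Sum>k<K. Z k \<omega>) / real K)\<^sup>2
          \<le> 32 * (W (floor_sqrt K) \<omega> / real (Suc (floor_sqrt K)) ^ 2)"
        using eventually_ge_at_top[of 1]
      proof eventually_elim
        case (elim K)
        define j where "j = floor_sqrt K"
        have j: "j\<^sup>2 \<le> K" "K < (Suc j)\<^sup>2" "1 \<le> j"
          using elim unfolding j_def
          by (auto simp: Suc_floor_sqrt_power2_gt le_floor_sqrt_iff)
        have "(\<Sum>k<K. Z k \<omega>) = T 0 (j\<^sup>2) \<omega> + T (j\<^sup>2) K \<omega>"
          using j(1) by (simp add: T_def sum.atLeastLessThan_concat atLeast0LessThan[symmetric])
        then have "(\<Sum>k<K. Z k \<omega>)\<^sup>2 \<le> 2 * ((T 0 (j\<^sup>2) \<omega>)\<^sup>2 + (T (j\<^sup>2) K \<omega>)\<^sup>2)"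
          using sum_squares_bound[of "T 0 (j\<^sup>2) \<omega>" "T (j\<^sup>2) K \<omega>"]
          by (simp add: power2_sum)
        also have "(T (j\<^sup>2) K \<omega>)\<^sup>2 \<le> (\<Sum>K=j\<^sup>2..<(Suc j)\<^sup>2. (T (j\<^sup>2) K \<omega>)\<^sup>2)"
          using j by (intro member_le_sum) auto
        finally have S2: "(\<Sum>k<K. Z k \<omega>)\<^sup>2 \<le> 2 * (W j \<omega> * real (Suc j) ^ 2)"
          by (simp add: W_def)
        have W0: "0 \<le> W j \<omega>"
          by (auto simp: W_def intro!: divide_nonneg_nonneg add_nonneg_nonneg sum_nonneg)
        have "real (Suc j) ^ 4 \<le> (2 * real j) ^ 4"
          using j(3) by (intro power_mono) auto
        also have "\<dots> = 16 * real (j\<^sup>2) ^ 2"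
          by (simp add: power_mult_distrib flip: power_mult)
        also have "\<dots> \<le> 16 * real K ^ 2"
          using j(1) by (intro mult_left_mono power_mono) auto
        finally have Kj: "real (Suc j) ^ 4 \<le> 16 * real K ^ 2" .
        have "(\<Sum>k<K. Z k \<omega>)\<^sup>2 * real (Suc j) ^ 2 \<le> 2 * (W j \<omega> * real (Suc j) ^ 2) * real (Suc j) ^ 2"
          using S2 by (intro mult_right_mono) auto
        also have "\<dots> = 2 * W j \<omega> * real (Suc j) ^ 4"
          by (simp add: power4_eq_xxxx power2_eq_square)
        also have "\<dots> \<le> 2 * W j \<omega> * (16 * real K ^ 2)"
          using Kj W0 by (intro mult_left_mono) auto
        finally have "(\<Sum>k<K. Z k \<omega>)\<^sup>2 * real (Suc j) ^ 2 \<le> 32 * W j \<omega> * real K ^ 2"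
          by simp
        then show ?case
          using elim by (simp add: power_divide divide_le_eq le_divide_eq flip: j_def del: of_nat_Suc)
      qed
    qed
    from tendsto_real_sqrt[OF this] show ?case
      by (simp only: real_sqrt_abs real_sqrt_zero tendsto_rabs_zero_iff)
  qed
qed

section \<open>Random affine recursions\<close>

lemma (in finite_measure) integrable_finite_range:
  fixes \<phi> :: "'b \<Rightarrow> real"
  assumes Y: "Y \<in> measurable M (count_space G)" and G: "finite G"
  shows "integrable M (\<lambda>\<omega>. \<phi> (Y \<omega>))"
proof (rule integrable_const_bound[where B = "\<Sum>x\<in>G. \<bar>\<phi> x\<bar>"])
  show "AE \<omega> in M. norm (\<phi> (Y \<omega>)) \<le> (\<Sum>x\<in>G. \<bar>\<phi> x\<bar>)"
  proof (rule AE_I2)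
    fix \<omega> assume "\<omega> \<in> space M"
    with Y have "Y \<omega> \<in> G" by (auto dest: measurable_space)
    then show "norm (\<phi> (Y \<omega>)) \<le> (\<Sum>x\<in>G. \<bar>\<phi> x\<bar>)"
      using member_le_sum[of "Y \<omega>" G "\<lambda>x. \<bar>\<phi> x\<bar>"] G by simp
  qed
  show "(\<lambda>\<omega>. \<phi> (Y \<omega>)) \<in> borel_measurable M"
    by (rule measurable_compose[OF Y]) simp
qed

text \<open>A finite product of finite discrete spaces is discrete, so every function of the
  restricted family is measurable.\<close>

lemma measurable_restrict_count_space:
  assumes "finite J" "finite F" "\<And>j. j \<in> J \<Longrightarrow> X j \<in> measurable M (count_space F)"
  shows "(\<lambda>\<omega>. restrict (\<lambda>j. X j \<omega>) J) \<in> measurable M (count_space (PiE J (\<lambda>_. F)))"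
proof -
  have "(\<lambda>\<omega>. restrict (\<lambda>j. X j \<omega>) J) \<in> measurable M (PiM J (\<lambda>_. count_space F))"
    using assms by (intro measurable_restrict) auto
  then show ?thesis
    using assms by (simp add: count_space_PiM_finite countable_finite)
qed

context prob_space
begin

text \<open>Disjoint blocks of an independent family are independent. Here the blocks take finitely
  many values, so arbitrary real functions of them are measurable and integrable, and the
  expectation factors.\<close>

lemma indep_vars_discrete_restrict:
  fixes \<Phi> \<Psi> :: "('i \<Rightarrow> 'b) \<Rightarrow> real"
  assumes indep: "indep_vars (\<lambda>_. count_space F) X I" and F: "finite F"
    and J: "J \<subseteq> I" "finite J" and K: "K \<subseteq> I" "finite K" and disj: "J \<inter> K = {}"
  shows "expectation (\<lambda>\<omega>. \<Phi> (restrict (\<lambda>j. X j \<omega>) J) * \<Psi> (restrict (\<lambda>j. X j \<omega>) K))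
    = expectation (\<lambda>\<omega>. \<Phi> (restrict (\<lambda>j. X j \<omega>) J)) * expectation (\<lambda>\<omega>. \<Psi> (restrict (\<lambda>j. X j \<omega>) K))"
proof -
  have rv: "random_variable (count_space F) (X j)" if "j \<in> I" for j
    using indep that by (simp add: indep_vars_def)
  have int: "integrable M (\<lambda>\<omega>. \<phi> (restrict (\<lambda>j. X j \<omega>) L))"
    if "L \<subseteq> I" "finite L" for L and \<phi> :: "('i \<Rightarrow> 'b) \<Rightarrow> real"
    using that F rv
    by (intro integrable_finite_range[OF measurable_restrict_count_space] finite_PiE) auto
  have sets_PiM: "PiM L (\<lambda>_. count_space F) = count_space (PiE L (\<lambda>_. F))"
    if "finite L" for L :: "'i set"
    using that F by (simp add: count_space_PiM_finite countable_finite)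
  have "indep_var borel (\<Phi> \<circ> (\<lambda>\<omega>. restrict (\<lambda>j. X j \<omega>) J)) borel (\<Psi> \<circ> (\<lambda>\<omega>. restrict (\<lambda>j. X j \<omega>) K))"
    using indep_var_restrict[OF indep disj J(1) K(1)] J K
    by (intro indep_var_compose[where ?N1.0 = borel and ?N2.0 = borel]) (auto simp: sets_PiM)
  from indep_var_lebesgue_integral[OF this] show ?thesis
    using int J K by (simp add: comp_def)
qed

text \<open>Summing \<open>Z\<close> telescopes: its average is (1 - r) times the average of
  \<open>Y\<close>, minus \<gamma>, plus (Y K - y) / K. A uniform bound on the second moments of
  \<open>Y\<close> serves twice, for the strong law applied to \<open>Z\<close> and for Y K / K ->
  0.\<close>

lemma AE_average_of_recursion:
  fixes X :: "nat \<Rightarrow> 'a \<Rightarrow> 'b" and a g :: "'b \<Rightarrow> real" and Y :: "nat \<Rightarrow> 'a \<Rightarrow> real"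
  assumes indep: "indep_vars (\<lambda>_. count_space F) X UNIV" and F: "finite F"
    and a01: "\<And>x. a x \<in> {0, 1}"
    and exp_a: "\<And>k. expectation (\<lambda>\<omega>. a (X k \<omega>)) = r" and "r < 1"
    and exp_g: "\<And>k. expectation (\<lambda>\<omega>. g (X k \<omega>)) = \<gamma>"
    and Y_0: "\<And>\<omega>. Y 0 \<omega> = y" and Y_Suc: "\<And>k \<omega>. Y (Suc k) \<omega> = a (X k \<omega>) * Y k \<omega> + g (X k \<omega>)"
  shows "AE \<omega> in M. (\<lambda>K. (\<Sum>k<K. Y k \<omega>) / real K) \<longlonglongrightarrow> \<gamma> / (1 - r)"
proof -
  have rv: "random_variable (count_space F) (X k)" for k
    using indep by (simp add: indep_vars_def)
  define hist where "hist k \<omega> = restrict (\<lambda>j. X j \<omega>) {..<k}" for k \<omega>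
  have hist_int: "integrable M (\<lambda>\<omega>. \<Phi> (hist k \<omega>))" for k and \<Phi> :: "(nat \<Rightarrow> 'b) \<Rightarrow> real"
    unfolding hist_def using F rv
    by (intro integrable_finite_range[OF measurable_restrict_count_space] finite_PiE) auto
  have cur_int: "integrable M (\<lambda>\<omega>. \<psi> (X k \<omega>))" for k and \<psi> :: "'b \<Rightarrow> real"
    using F rv by (intro integrable_finite_range)
  have hist_indep: "expectation (\<lambda>\<omega>. \<Phi> (hist k \<omega>) * \<psi> (X k \<omega>))
      = expectation (\<lambda>\<omega>. \<Phi> (hist k \<omega>)) * expectation (\<lambda>\<omega>. \<psi> (X k \<omega>))"
    for k and \<Phi> :: "(nat \<Rightarrow> 'b) \<Rightarrow> real" and \<psi> :: "'b \<Rightarrow> real"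
    unfolding hist_def
    using indep_vars_discrete_restrict[OF indep F, of "{..<k}" "{k}" \<Phi> "\<lambda>x. \<psi> (x k)"] by simp

  \<comment> \<open>\<open>yf\<close> exhibits \<open>Y k\<close> as a deterministic function of the
    first k states, which makes it a function of \<open>hist k\<close> and hence independent of
    \<open>X k\<close>.\<close>
  define yf where "yf x k = rec_nat y (\<lambda>k u. a (x k) * u + g (x k)) k" for x k
  have yf_cong: "yf x k = yf x' k" if "\<And>j. j < k \<Longrightarrow> x j = x' j" for x x' k
    using that by (induction k) (auto simp: yf_def)
  have Y_yf: "Y k \<omega> = yf (\<lambda>j. X j \<omega>) k" for k \<omega>
    by (induction k) (simp_all add: Y_0 Y_Suc yf_def)
  have Y_hist: "Y k \<omega> = yf (hist l \<omega>) k" if "k \<le> l" for k l \<omega>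
    unfolding Y_yf using that by (intro yf_cong) (simp add: hist_def)
  have X_hist: "X k \<omega> = hist l \<omega> k" if "k < l" for k l \<omega>
    using that by (simp add: hist_def)

  \<comment> \<open>This is Y (k+1) - r Y k - \<gamma> with the current state isolated in the
    centred factors a - r and g - \<gamma>. For k < l, both \<open>Z k\<close> and
    \<open>Y l\<close> depend on states before l only, so the factors at l annihilate the mixed
    moment.\<close>
  define Z where "Z k \<omega> = (a (X k \<omega>) - r) * Y k \<omega> + (g (X k \<omega>) - \<gamma>)" for k \<omega>
  define \<phi> where "\<phi> k x = (a (x k) - r) * yf x k + (g (x k) - \<gamma>)" for k x
  have Z_hist: "Z k \<omega> = \<phi> k (hist l \<omega>)" if "k < l" for k l \<omega>
    using that by (simp add: Z_def \<phi>_def X_hist[of k l] Y_hist[of k l])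
  have ZZ_int: "integrable M (\<lambda>\<omega>. Z k \<omega> * Z l \<omega>)" for k l
    using hist_int[of "\<lambda>x. \<phi> k x * \<phi> l x" "Suc (max k l)"]
    by (simp add: Z_hist[of _ "Suc (max k l)"])
  have Y2_int: "integrable M (\<lambda>\<omega>. (Y k \<omega>)\<^sup>2)" for k
    unfolding Y_hist[OF order.refl] by (rule hist_int)

  have orth: "expectation (\<lambda>\<omega>. Z k \<omega> * Z l \<omega>) = 0" if "k < l" for k l
  proof -
    have int: "integrable M (\<lambda>\<omega>. (Z k \<omega> * Y l \<omega>) * (a (X l \<omega>) - r))"
      "integrable M (\<lambda>\<omega>. Z k \<omega> * (g (X l \<omega>) - \<gamma>))"
      using hist_int[of "\<lambda>x. (\<phi> k x * yf x l) * (a (x l) - r)" "Suc l"]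
        hist_int[of "\<lambda>x. \<phi> k x * (g (x l) - \<gamma>)" "Suc l"] that
      by (simp_all add: Z_hist[of k "Suc l"] Y_hist[of l "Suc l"] X_hist[of l "Suc l"])
    have "Z k \<omega> * Z l \<omega> = (Z k \<omega> * Y l \<omega>) * (a (X l \<omega>) - r) + Z k \<omega> * (g (X l \<omega>) - \<gamma>)" for \<omega>
      by (subst (2) Z_def) (simp add: algebra_simps)
    then have "expectation (\<lambda>\<omega>. Z k \<omega> * Z l \<omega>)
        = expectation (\<lambda>\<omega>. (Z k \<omega> * Y l \<omega>) * (a (X l \<omega>) - r))
          + expectation (\<lambda>\<omega>. Z k \<omega> * (g (X l \<omega>) - \<gamma>))"
      using int by simp
    also have "\<dots> = 0"
      using hist_indep[of "\<lambda>x. \<phi> k x * yf x l" l "\<lambda>x. a x - r"]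
        hist_indep[of "\<phi> k" l "\<lambda>x. g x - \<gamma>"] cur_int[of a l] cur_int[of g l] that
      by (simp add: exp_a exp_g prob_space Z_hist[of k l] Y_hist[of l l])
    finally show ?thesis .
  qed

  have r: "0 \<le> r"
    unfolding exp_a[of 0, symmetric]
    by (rule Bochner_Integration.integral_nonneg) (use a01 in \<open>metis insert_iff order.refl singletonD zero_le_one\<close>)
  define p where "p = 1 - r"
  have p: "0 < p" "p \<le> 1" using \<open>r < 1\<close> r by (auto simp: p_def)
  define R where "R = (\<Sum>x\<in>F. \<bar>g x\<bar>) + \<bar>\<gamma>\<bar>"
  have gR: "(g (X k \<omega>))\<^sup>2 \<le> R\<^sup>2" "(g (X k \<omega>) - \<gamma>)\<^sup>2 \<le> R\<^sup>2" if "\<omega> \<in> space M" for k \<omega>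
  proof -
    have "X k \<omega> \<in> F" using measurable_space[OF rv that] by simp
    then have "\<bar>g (X k \<omega>)\<bar> \<le> (\<Sum>x\<in>F. \<bar>g x\<bar>)"
      using member_le_sum[of "X k \<omega>" F "\<lambda>x. \<bar>g x\<bar>"] F by simp
    then have "\<bar>g (X k \<omega>)\<bar> \<le> \<bar>R\<bar>" "\<bar>g (X k \<omega>) - \<gamma>\<bar> \<le> \<bar>R\<bar>"
      by (auto simp: R_def)
    then show "(g (X k \<omega>))\<^sup>2 \<le> R\<^sup>2" "(g (X k \<omega>) - \<gamma>)\<^sup>2 \<le> R\<^sup>2"
      by (auto simp only: abs_le_square_iff)
  qed
  \<comment> \<open>\<open>B\<close> is the constant left by (u + v)^2 <= (1 + p) u^2 + (1 + 1 / p)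
    v^2. With weight p the second moment is contracted by (1 + p) (1 - p) = 1 - p^2, and y^2 + B /
    p^2 is a bound preserved by e -> (1 - p^2) e + B.\<close>
  define B where "B = (1 + 1 / p) * R\<^sup>2"
  have B: "0 \<le> B" using p by (simp add: B_def)
  have Y2_bound: "expectation (\<lambda>\<omega>. (Y k \<omega>)\<^sup>2) \<le> y\<^sup>2 + B / p\<^sup>2" for k
  proof (induction k)
    case 0
    show ?case using B by (simp add: Y_0 prob_space)
  next
    case (Suc k)
    have int: "integrable M (\<lambda>\<omega>. (Y k \<omega>)\<^sup>2 * a (X k \<omega>))"
      using hist_int[of "\<lambda>x. (yf x k)\<^sup>2 * a (x k)" "Suc k"]
      by (simp add: X_hist[of k "Suc k"] Y_hist[of k "Suc k"])
    have "expectation (\<lambda>\<omega>. (Y (Suc k) \<omega>)\<^sup>2)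
        \<le> expectation (\<lambda>\<omega>. (1 + p) * ((Y k \<omega>)\<^sup>2 * a (X k \<omega>)) + B)"
    proof (intro integral_mono Y2_int Bochner_Integration.integrable_add integrable_mult_right int)
      fix \<omega> assume \<omega>: "\<omega> \<in> space M"
      have young: "(u + v)\<^sup>2 \<le> (1 + p) * u\<^sup>2 + (1 + 1 / p) * v\<^sup>2" for u v :: real
      proof -
        have "0 \<le> (p * u - v)\<^sup>2 / p" using p by simp
        also have "\<dots> = (1 + p) * u\<^sup>2 + (1 + 1 / p) * v\<^sup>2 - (u + v)\<^sup>2"
          using p by (simp add: power2_eq_square field_simps)
        finally show ?thesis by simp
      qed
      \<comment> \<open>An indicator equals its square, so the mean square factors as r times that
        of \<open>Y k\<close>.\<close>
      have "(a (X k \<omega>) * Y k \<omega>)\<^sup>2 = (Y k \<omega>)\<^sup>2 * a (X k \<omega>)"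
        using a01[of "X k \<omega>"] by auto
      moreover have "(1 + 1 / p) * (g (X k \<omega>))\<^sup>2 \<le> B"
        unfolding B_def using p gR(1)[OF \<omega>] by (intro mult_left_mono) auto
      ultimately show "(Y (Suc k) \<omega>)\<^sup>2 \<le> (1 + p) * ((Y k \<omega>)\<^sup>2 * a (X k \<omega>)) + B"
        using young[of "a (X k \<omega>) * Y k \<omega>" "g (X k \<omega>)"] by (simp add: Y_Suc)
    qed simp
    also have "\<dots> = (1 + p) * expectation (\<lambda>\<omega>. (Y k \<omega>)\<^sup>2 * a (X k \<omega>)) + B"
      using int by (simp add: prob_space)
    also have "expectation (\<lambda>\<omega>. (Y k \<omega>)\<^sup>2 * a (X k \<omega>)) = expectation (\<lambda>\<omega>. (Y k \<omega>)\<^sup>2) * (1 - p)"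
      using hist_indep[of "\<lambda>x. (yf x k)\<^sup>2" k a] by (simp add: Y_hist[of k k] exp_a p_def)
    also have "(1 + p) * (expectation (\<lambda>\<omega>. (Y k \<omega>)\<^sup>2) * (1 - p)) + B
        \<le> (1 + p) * ((y\<^sup>2 + B / p\<^sup>2) * (1 - p)) + B"
      using Suc p by (intro add_right_mono mult_left_mono mult_right_mono) auto
    also have "\<dots> = y\<^sup>2 * (1 - p\<^sup>2) + B / p\<^sup>2"
      using p by (simp add: field_simps power2_eq_square)
    also have "\<dots> \<le> y\<^sup>2 + B / p\<^sup>2"
      using mult_left_mono[of "1 - p\<^sup>2" 1 "y\<^sup>2"] by simp
    finally show ?case .
  qed

  have "expectation (\<lambda>\<omega>. Z k \<omega> * Z k \<omega>) \<le> 2 * (y\<^sup>2 + B / p\<^sup>2) + 2 * R\<^sup>2" for k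
  proof -
    have "expectation (\<lambda>\<omega>. Z k \<omega> * Z k \<omega>) \<le> expectation (\<lambda>\<omega>. 2 * (Y k \<omega>)\<^sup>2 + 2 * R\<^sup>2)"
    proof (intro integral_mono ZZ_int Bochner_Integration.integrable_add integrable_mult_right Y2_int)
      fix \<omega> assume \<omega>: "\<omega> \<in> space M"
      have "\<bar>a (X k \<omega>) - r\<bar> \<le> 1"
        using a01[of "X k \<omega>"] r \<open>r < 1\<close> by auto
      then have "(a (X k \<omega>) - r)\<^sup>2 \<le> 1"
        by (simp add: abs_square_le_1)
      then have "((a (X k \<omega>) - r) * Y k \<omega>)\<^sup>2 \<le> (Y k \<omega>)\<^sup>2"
        by (simp add: power_mult_distrib mult_left_le_one_le)
      moreover have "(u + v)\<^sup>2 \<le> 2 * u\<^sup>2 + 2 * v\<^sup>2" for u v :: real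
        using sum_squares_bound[of u v] by (simp add: power2_sum)
      from this[of "(a (X k \<omega>) - r) * Y k \<omega>" "g (X k \<omega>) - \<gamma>"]
      have "Z k \<omega> * Z k \<omega> \<le> 2 * ((a (X k \<omega>) - r) * Y k \<omega>)\<^sup>2 + 2 * (g (X k \<omega>) - \<gamma>)\<^sup>2"
        by (simp add: Z_def power2_eq_square)
      ultimately show "Z k \<omega> * Z k \<omega> \<le> 2 * (Y k \<omega>)\<^sup>2 + 2 * R\<^sup>2"
        using gR(2)[OF \<omega>, of k] by linarith
    qed simp
    also have "\<dots> = 2 * expectation (\<lambda>\<omega>. (Y k \<omega>)\<^sup>2) + 2 * R\<^sup>2"
      using Y2_int by (simp add: prob_space)
    finally show ?thesis using Y2_bound[of k] by simp
  qed
  from orthogonal_strong_law[OF ZZ_int orth this]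
  have "AE \<omega> in M. (\<lambda>K. (\<Sum>k<K. Z k \<omega>) / real K) \<longlonglongrightarrow> 0" .
  moreover have "AE \<omega> in M. (\<lambda>k. (Y k \<omega>)\<^sup>2 / real (Suc k) ^ 2) \<longlonglongrightarrow> 0"
    by (rule AE_scaled_tendsto_0[OF Y2_int _ Y2_bound]) simp
  ultimately show ?thesis
  proof eventually_elim
    case (elim \<omega>)
    have "(\<lambda>k. \<bar>Y k \<omega> / real (Suc k)\<bar>) \<longlonglongrightarrow> 0"
      using tendsto_real_sqrt[OF elim(2)]
      by (simp only: power_divide[symmetric] real_sqrt_abs real_sqrt_zero)
    then have Y_over: "(\<lambda>k. Y k \<omega> / real (Suc k)) \<longlonglongrightarrow> 0"
      by (simp only: tendsto_rabs_zero_iff)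
    have "(\<lambda>k. Y k \<omega> / real (Suc k) * (real (Suc k) / real k)) \<longlonglongrightarrow> 0 * 1"
      by (intro tendsto_mult Y_over LIMSEQ_Suc_n_over_n)
    then have Y_over: "(\<lambda>k. Y k \<omega> / real k) \<longlonglongrightarrow> 0"
      by (simp del: of_nat_Suc)
    have "(\<lambda>K. ((\<Sum>k<K. Z k \<omega>) / real K + \<gamma> - Y K \<omega> / real K + y / real K) / (1 - r))
        \<longlonglongrightarrow> (0 + \<gamma> - 0 + 0) / (1 - r)"
      using \<open>r < 1\<close> by (intro tendsto_intros elim(1) Y_over lim_const_over_n) auto
    moreover have "\<forall>\<^sub>F K in sequentially.
        ((\<Sum>k<K. Z k \<omega>) / real K + \<gamma> - Y K \<omega> / real K + y / real K) / (1 - r)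
        = (\<Sum>k<K. Y k \<omega>) / real K"
      using eventually_gt_at_top[of 0]
    proof eventually_elim
      case (elim K)
      have "Z k \<omega> = (Y (Suc k) \<omega> - Y k \<omega>) + (1 - r) * Y k \<omega> - \<gamma>" for k
        by (simp add: Z_def Y_Suc algebra_simps)
      then have "(\<Sum>k<K. Z k \<omega>) = (\<Sum>k<K. (Y (Suc k) \<omega> - Y k \<omega>) + (1 - r) * Y k \<omega> - \<gamma>)"
        by simp
      also have "\<dots> = Y K \<omega> - y + (1 - r) * (\<Sum>k<K. Y k \<omega>) - real K * \<gamma>"
        using sum_lessThan_telescope[of "\<lambda>k. Y k \<omega>" K]
        by (simp add: sum.distrib sum_subtractf Y_0 flip: sum_distrib_left)
      finally have "(\<Sum>k<K. Z k \<omega>) + real K * \<gamma> - Y K \<omega> + y = (1 - r) * (\<Sum>k<K. Y k \<omega>)"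
        by simp
      moreover have "(\<Sum>k<K. Z k \<omega>) / real K + \<gamma> - Y K \<omega> / real K + y / real K
          = ((\<Sum>k<K. Z k \<omega>) + real K * \<gamma> - Y K \<omega> + y) / real K"
        using elim by (simp add: add_divide_distrib diff_divide_distrib)
      ultimately show ?case
        using \<open>r < 1\<close> by simp
    qed
    ultimately show ?case
      by (simp add: Lim_transform_eventually)
  qed
qed

end

section \<open>Time averages and age on a sample path\<close>

text \<open>The right end point is left free because the age may jump there; a single point does not
  change the integral.\<close>

lemma has_integral_unit_slope:
  fixes f :: "real \<Rightarrow> real"
  assumes f: "\<And>t. s \<le> t \<Longrightarrow> t < t' \<Longrightarrow> f t = v + (t - s)" and "s \<le> t'"
  shows "(f has_integral v * (t' - s) + (t' - s)\<^sup>2 / 2) {s..t'}"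
proof -
  have "((\<lambda>t. v + (t - s)) has_integral
      (v * (t' - s) + (t' - s)\<^sup>2 / 2) - (v * (s - s) + (s - s)\<^sup>2 / 2)) {s..t'}"
    using \<open>s \<le> t'\<close>
    by (intro fundamental_theorem_of_calculus)
      (auto intro!: derivative_eq_intros simp flip: has_real_derivative_iff_has_vector_derivative)
  then show ?thesis
    by (intro has_integral_spike_finite[of "{t'}" _ f]) (use f in auto)
qed

text \<open>Each complete period contributes exactly d u k + d^2 / 2. The incomplete last one
  contributes at most |u (N \<tau>)| d + d^2 / 2, negligible against \<tau> because convergence of
  the averages forces u K / K -> 0.\<close>

lemma mean_of_sawtooth:
  fixes f :: "real \<Rightarrow> real" and u :: "nat \<Rightarrow> real" and d y :: real
  assumes d: "0 < d"
    and f: "\<And>k t. real k * d \<le> t \<Longrightarrow> t < real (Suc k) * d \<Longrightarrow> f t = u k + (t - real k * d)"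
    and u: "(\<lambda>K. (\<Sum>k<K. u k) / real K) \<longlonglongrightarrow> y"
  shows "((\<lambda>\<tau>. 1 / \<tau> * integral {0..\<tau>} f) \<longlongrightarrow> y + d / 2) at_top"
proof -
  have seg: "(f has_integral u k * s + s\<^sup>2 / 2) {real k * d..real k * d + s}"
    if "0 \<le> s" "s \<le> d" for k s
    using has_integral_unit_slope[of "real k * d" "real k * d + s" f "u k"] that
    by (auto simp: f algebra_simps)
  have whole: "(f has_integral d * (\<Sum>k<K. u k) + real K * d\<^sup>2 / 2) {0..real K * d}" for K
  proof (induction K)
    case 0
    show ?case by (simp add: has_integral_refl)
  next
    case (Suc K)
    have "(f has_integral (d * (\<Sum>k<K. u k) + real K * d\<^sup>2 / 2) + (u K * d + d\<^sup>2 / 2))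
        {0..real K * d + d}"
      by (rule has_integral_combine[OF _ _ Suc seg[of d K]]) (use d in auto)
    then show ?case by (simp add: algebra_simps add_divide_distrib)
  qed
  \<comment> \<open>Split \<tau> into \<open>N \<tau>\<close> complete periods and the elapsed part
    \<open>s \<tau>\<close> of the current one.\<close>
  define N where "N \<tau> = nat \<lfloor>\<tau> / d\<rfloor>" for \<tau>
  define s where "s \<tau> = \<tau> - real (N \<tau>) * d" for \<tau>
  have N: "real (N \<tau>) \<le> \<tau> / d" "\<tau> / d < real (N \<tau>) + 1" if "0 \<le> \<tau>" for \<tau>
    using that d by (auto simp: N_def)
  have s: "0 \<le> s \<tau>" "s \<tau> \<le> d" if "0 \<le> \<tau>" for \<tau>
    using N[OF that] d by (auto simp: s_def field_simps)
  have integral_f: "integral {0..\<tau>} f = (d * (\<Sum>k<N \<tau>. u k) + real (N \<tau>) * d\<^sup>2 / 2)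
      + (u (N \<tau>) * s \<tau> + (s \<tau>)\<^sup>2 / 2)" if "0 \<le> \<tau>" for \<tau>
  proof (rule integral_unique)
    show "(f has_integral (d * (\<Sum>k<N \<tau>. u k) + real (N \<tau>) * d\<^sup>2 / 2)
      + (u (N \<tau>) * s \<tau> + (s \<tau>)\<^sup>2 / 2)) {0..\<tau>}"
      using has_integral_combine[OF _ _ whole[of "N \<tau>"] seg[of "s \<tau>" "N \<tau>"]] s[OF that] d
      by (simp add: s_def)
  qed
  have N_lim: "filterlim N at_top at_top"
    unfolding filterlim_at_top
  proof
    fix Z
    show "\<forall>\<^sub>F \<tau> in at_top. Z \<le> N \<tau>"
      using eventually_ge_at_top[of "real Z * d"]
      by eventually_elim (use d in \<open>auto simp: N_def field_simps intro!: le_nat_floor\<close>)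
  qed
  have over_lim: "((\<lambda>\<tau>. C / \<tau>) \<longlongrightarrow> 0) at_top" for C :: real
    by (rule tendsto_divide_0[OF tendsto_const])
      (simp add: filterlim_at_top_imp_at_infinity filterlim_ident)
  have N_ratio: "((\<lambda>\<tau>. real (N \<tau>) / \<tau>) \<longlongrightarrow> 1 / d) at_top"
  proof -
    have "((\<lambda>\<tau>. 1 / d - real (N \<tau>) / \<tau>) \<longlongrightarrow> 0) at_top"
    proof (rule tendsto_sandwich[OF _ _ tendsto_const over_lim[of 1]])
      show "\<forall>\<^sub>F \<tau> in at_top. 0 \<le> 1 / d - real (N \<tau>) / \<tau>"
        using eventually_gt_at_top[of 0]
        by eventually_elim (use N(1) d in \<open>auto simp: field_simps\<close>)
      show "\<forall>\<^sub>F \<tau> in at_top. 1 / d - real (N \<tau>) / \<tau> \<le> 1 / \<tau>"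
        using eventually_gt_at_top[of 0]
      proof eventually_elim
        case (elim \<tau>)
        then have "1 / d \<le> (real (N \<tau>) + 1) / \<tau>"
          using N(2)[of \<tau>] d by (simp add: field_simps)
        then show ?case by (simp add: add_divide_distrib)
      qed
    qed
    from tendsto_diff[OF tendsto_const[of "1 / d"] this] show ?thesis by simp
  qed
  have u_over: "(\<lambda>K. u K / real K) \<longlonglongrightarrow> 0"
  proof -
    have "(\<lambda>K. (\<Sum>k<Suc K. u k) / real (Suc K) * (real (Suc K) / real K) - (\<Sum>k<K. u k) / real K)
        \<longlonglongrightarrow> y * 1 - y"
      using u by (intro tendsto_diff tendsto_mult LIMSEQ_Suc_n_over_n LIMSEQ_Suc[OF u])
    moreover have "(\<Sum>k<Suc K. u k) / real (Suc K) * (real (Suc K) / real K) - (\<Sum>k<K. u k) / real K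
        = u K / real K" for K
      by (simp add: diff_divide_distrib[symmetric] del: of_nat_Suc)
    ultimately show ?thesis by simp
  qed
  have s_over: "((\<lambda>\<tau>. (s \<tau>)\<^sup>2 / 2 / \<tau>) \<longlongrightarrow> 0) at_top"
  proof (rule tendsto_sandwich[OF _ _ tendsto_const over_lim[of "d\<^sup>2 / 2"]])
    show "\<forall>\<^sub>F \<tau> in at_top. 0 \<le> (s \<tau>)\<^sup>2 / 2 / \<tau>"
      using eventually_gt_at_top[of 0] by eventually_elim auto
    show "\<forall>\<^sub>F \<tau> in at_top. (s \<tau>)\<^sup>2 / 2 / \<tau> \<le> d\<^sup>2 / 2 / \<tau>"
      using eventually_gt_at_top[of 0]
      by eventually_elim (use s in \<open>auto intro!: divide_right_mono power_mono\<close>)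
  qed
  have us_over: "((\<lambda>\<tau>. u (N \<tau>) / real (N \<tau>) * s \<tau>) \<longlongrightarrow> 0) at_top"
  proof (rule Lim_null_comparison[where g = "\<lambda>\<tau>. \<bar>u (N \<tau>) / real (N \<tau>)\<bar> * d"])
    show "\<forall>\<^sub>F \<tau> in at_top. norm (u (N \<tau>) / real (N \<tau>) * s \<tau>) \<le> \<bar>u (N \<tau>) / real (N \<tau>)\<bar> * d"
      using eventually_ge_at_top[of 0]
      by eventually_elim (use s in \<open>auto simp: abs_mult intro!: mult_left_mono divide_right_mono\<close>)
    show "((\<lambda>\<tau>. \<bar>u (N \<tau>) / real (N \<tau>)\<bar> * d) \<longlongrightarrow> 0) at_top"
      by (intro tendsto_mult_left_zero tendsto_rabs_zero filterlim_compose[OF u_over N_lim])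
  qed
  have "((\<lambda>\<tau>. (d * ((\<Sum>k<N \<tau>. u k) / real (N \<tau>)) + d\<^sup>2 / 2 + u (N \<tau>) / real (N \<tau>) * s \<tau>)
      * (real (N \<tau>) / \<tau>) + (s \<tau>)\<^sup>2 / 2 / \<tau>) \<longlongrightarrow> (d * y + d\<^sup>2 / 2 + 0) * (1 / d) + 0) at_top"
    by (intro tendsto_add tendsto_mult tendsto_const filterlim_compose[OF u N_lim]
        us_over N_ratio s_over)
  also have "(d * y + d\<^sup>2 / 2 + 0) * (1 / d) + 0 = y + d / 2"
    using d by (simp add: field_simps power2_eq_square)
  finally show ?thesis
  proof (rule Lim_transform_eventually)
    have "\<forall>\<^sub>F \<tau> in at_top. 0 < N \<tau>"
      using N_lim[unfolded filterlim_at_top, rule_format, of 1]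
      by (simp add: Suc_le_eq)
    with eventually_gt_at_top[of 0]
    show "\<forall>\<^sub>F \<tau> in at_top. (d * ((\<Sum>k<N \<tau>. u k) / real (N \<tau>)) + d\<^sup>2 / 2 + u (N \<tau>) / real (N \<tau>) * s \<tau>)
        * (real (N \<tau>) / \<tau>) + (s \<tau>)\<^sup>2 / 2 / \<tau> = 1 / \<tau> * integral {0..\<tau>} f"
      by eventually_elim (auto simp: integral_f field_simps)
  qed
qed

section \<open>Interference cancellation under renaming, and the age at frame ends\<close>

text \<open>\<sigma> carries a cancellation step to a cancellation step: the image of a singleton
  slot is a singleton, and injectivity lets removal commute with images. The converse implication
  comes from applying the lemma to the inverse renaming.\<close>

lemma sic_decoded_relabel:
  assumes inj: "inj_on \<sigma> U" and r: "\<And>i. i \<in> U \<Longrightarrow> r' (\<sigma> i) = r i" and i: "i \<in> sic_decoded r U"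
  shows "\<sigma> i \<in> sic_decoded r' (\<sigma> ` U)"
proof -
  have "Q \<subseteq> U \<and> (sic_step r')\<^sup>*\<^sup>* (\<sigma> ` U) (\<sigma> ` Q)" if "(sic_step r)\<^sup>*\<^sup>* U Q" for Q
    using that
  proof (induction rule: rtranclp_induct)
    case base
    show ?case by simp
  next
    case (step P Q)
    from \<open>sic_step r P Q\<close> obtain k j where k: "{l \<in> P. k \<in> r l} = {j}" and Q: "Q = P - {j}"
      by (auto elim: sic_step.cases)
    have P: "P \<subseteq> U" using step.IH by simp
    have "{l \<in> \<sigma> ` P. k \<in> r' l} = \<sigma> ` {l \<in> P. k \<in> r l}"
      using P r by auto
    then have "sic_step r' (\<sigma> ` P) (\<sigma> ` P - {\<sigma> j})"
      unfolding k by (intro sic_step.intros[of _ k]) simp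
    moreover have "\<sigma> ` P - {\<sigma> j} = \<sigma> ` Q"
      using inj_on_image_set_diff[OF inj, of P "{j}"] P k by (auto simp: Q)
    ultimately show ?case
      using step.IH Q by (auto intro: rtranclp.rtrancl_into_rtrancl)
  qed
  moreover from i obtain Q where Q: "i \<in> U" "(sic_step r)\<^sup>*\<^sup>* U Q" "i \<notin> Q"
    by (auto simp: sic_decoded_def)
  ultimately have "(sic_step r')\<^sup>*\<^sup>* (\<sigma> ` U) (\<sigma> ` Q)" "\<sigma> i \<notin> \<sigma> ` Q"
    using inj_on_image_mem_iff[OF inj] by auto
  then show ?thesis
    using Q(1) unfolding sic_decoded_def by blast
qed

lemma sic_decoded_cong:
  assumes "\<And>i. i \<in> U \<Longrightarrow> r i = r' i"
  shows "sic_decoded r U = sic_decoded r' U"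
  using sic_decoded_relabel[of id U r r'] sic_decoded_relabel[of id U r' r] assms by auto

lemma decoded_less_2: "f < 2 \<Longrightarrow> decoded n m a c f = {}"
  by (auto simp: decoded_def transmitters_def sic_decoded_def)

text \<open>By time t exactly the frames up to k have ended, and nothing is decoded before frame 2.
  The set is thus finite, so the \<open>Max\<close> in \<open>last_stamp\<close> is
  meaningful.\<close>

lemma reception_frames_eq:
  assumes "m \<ge> 1" "real k * real m \<le> t" "t < real (Suc k) * real m"
  shows "reception_frames n m a c i t = {f \<in> {2..k}. i \<in> decoded n m a c f}"
proof -
  have "real (f * m) \<le> t \<longleftrightarrow> f \<le> k" for f
  proof
    assume "real (f * m) \<le> t"
    then have "real f * real m < real (Suc k) * real m"
      using assms(3) by simp
    then show "f \<le> k" using \<open>m \<ge> 1\<close> by (simp del: of_nat_Suc)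
  next
    assume "f \<le> k"
    then have "real f * real m \<le> real k * real m" by (intro mult_right_mono) auto
    then show "real (f * m) \<le> t" using assms(2) by simp
  qed
  moreover have "f \<ge> 2" if "i \<in> decoded n m a c f" for f
    using that decoded_less_2[of f] by (cases "f < 2") auto
  ultimately show ?thesis by (auto simp: reception_frames_def)
qed

lemma age_within_frame:
  assumes "m \<ge> 1" "real k * real m \<le> t" "t < real (Suc k) * real m"
  shows "age n m y0 a c i t = age n m y0 a c i (real k * real m) + (t - real k * real m)"
proof -
  have "reception_frames n m a c i t = reception_frames n m a c i (real k * real m)"
    using assms by (simp add: reception_frames_eq[of m k])
  then show ?thesis by (simp add: age_def last_stamp_def)
qed

lemma age_frame_1: "m \<ge> 1 \<Longrightarrow> age n m y0 a c i (real (Suc 0) * real m) = real m - y0 i"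
  by (simp add: age_def last_stamp_def reception_frames_eq[of m 1])

text \<open>If frame k + 1 is decoded it is the latest reception and its stamp takes over; otherwise
  the old stamp persists for m more slots. This is the pathwise source of the affine
  recursion.\<close>

lemma age_frame_Suc:
  assumes "m \<ge> 1" "k \<ge> 1"
  shows "age n m y0 a c i (real (Suc k) * real m) =
    (if i \<in> decoded n m a c (Suc k) then real (Suc k) * real m - time_stamp m a i (Suc k)
     else age n m y0 a c i (real k * real m) + real m)"
proof -
  define R where "R j = {f \<in> {2..j}. i \<in> decoded n m a c f}" for j
  have R: "reception_frames n m a c i (real j * real m) = R j" for j
    using \<open>m \<ge> 1\<close> by (simp add: reception_frames_eq[of m j] R_def)
  have "R (Suc k) = insert (Suc k) (R k)" if "i \<in> decoded n m a c (Suc k)"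
    using that \<open>k \<ge> 1\<close> by (auto simp: R_def le_Suc_eq)
  moreover have "R (Suc k) = R k" if "i \<notin> decoded n m a c (Suc k)"
    using that by (auto simp: R_def le_Suc_eq)
  moreover have "Max (insert (Suc k) (R k)) = Suc k"
    by (intro Max_eqI) (auto simp: R_def)
  ultimately show ?thesis
    unfolding age_def last_stamp_def R by (simp add: distrib_right)
qed

section \<open>Finite product spaces of discrete variables\<close>

text \<open>Each \<open>X (\<rho> z)\<close> is read off the block {\<rho> z}, and injectivity makes
  these blocks disjoint.\<close>

lemma (in prob_space) indep_vars_reindex:
  assumes "indep_vars (\<lambda>_. N) X I" "inj_on \<rho> J" "\<rho> ` J \<subseteq> I"
  shows "indep_vars (\<lambda>_. N) (\<lambda>z. X (\<rho> z)) J"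
proof -
  have "indep_vars (\<lambda>z. PiM {\<rho> z} (\<lambda>_. N)) (\<lambda>z \<omega>. restrict (\<lambda>x. X x \<omega>) {\<rho> z}) J"
    using assms by (intro indep_vars_restrict) (auto simp: disjoint_family_on_def inj_on_def)
  then have "indep_vars (\<lambda>_. N) (\<lambda>z \<omega>. (restrict (\<lambda>x. X x \<omega>) {\<rho> z}) (\<rho> z)) J"
    by (rule indep_vars_compose2) (simp add: measurable_component_singleton)
  then show ?thesis by simp
qed

text \<open>By independence both joint laws are products of their marginals, so equal marginals give
  equal joint laws. This later allows users and frames to be exchanged.\<close>

lemma (in prob_space) expectation_restrict_eq:
  fixes F :: "('i \<Rightarrow> 'b) \<Rightarrow> real"
  assumes X: "indep_vars (\<lambda>_. count_space V) X J" and Y: "indep_vars (\<lambda>_. count_space V) Y J"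
    and V: "finite V" and J: "finite J" "J \<noteq> {}"
    and eq: "\<And>z. z \<in> J \<Longrightarrow> distr M (count_space V) (X z) = distr M (count_space V) (Y z)"
  shows "expectation (\<lambda>\<omega>. F (restrict (\<lambda>z. X z \<omega>) J)) = expectation (\<lambda>\<omega>. F (restrict (\<lambda>z. Y z \<omega>) J))"
proof -
  have PiM: "PiM J (\<lambda>_. count_space V) = count_space (PiE J (\<lambda>_. V))"
    using V J by (simp add: count_space_PiM_finite countable_finite)
  have *: "expectation (\<lambda>\<omega>. F (restrict (\<lambda>z. X z \<omega>) J))
      = (\<integral>x. F x \<partial>PiM J (\<lambda>z. distr M (count_space V) (X z)))"
    if X: "indep_vars (\<lambda>_. count_space V) X J" for X
  proof -
    have rv: "random_variable (count_space V) (X z)" if "z \<in> J" for z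
      using X that by (simp add: indep_vars_def)
    have "PiM J (\<lambda>z. distr M (count_space V) (X z))
        = distr M (count_space (PiE J (\<lambda>_. V))) (\<lambda>\<omega>. restrict (\<lambda>z. X z \<omega>) J)"
      using iffD1[OF indep_vars_iff_distr_eq_PiM'[OF J(2) rv] X] by (simp add: PiM)
    then show ?thesis
      using V J rv by (simp add: integral_distr measurable_restrict_count_space)
  qed
  show ?thesis
    unfolding *[OF X] *[OF Y] by (simp add: eq cong: PiM_cong)
qed

text \<open>
  A state \<open>x\<close> describes the traffic of one frame: \<open>x (i, 0)\<close> is the placement of user \<open>i\<close>, and for
  \<open>j \<ge> 1\<close> the set \<open>x (i, j)\<close> is nonempty iff user \<open>i\<close> was active in slot \<open>j\<close> of the previous frame.
\<close>

definition active_in :: "nat \<Rightarrow> (nat \<times> nat \<Rightarrow> nat set) \<Rightarrow> nat \<Rightarrow> bool" where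
  "active_in m x i \<longleftrightarrow> (\<exists>j\<in>{1..m}. x (i, j) \<noteq> {})"

definition last_active :: "nat \<Rightarrow> (nat \<times> nat \<Rightarrow> nat set) \<Rightarrow> nat \<Rightarrow> nat" where
  "last_active m x i = Max {j \<in> {1..m}. x (i, j) \<noteq> {}}"

definition state_decoded :: "nat \<Rightarrow> nat \<Rightarrow> (nat \<times> nat \<Rightarrow> nat set) \<Rightarrow> nat set" where
  "state_decoded n m x = sic_decoded (\<lambda>i. x (i, 0)) {i \<in> {1..n}. active_in m x i}"

lemma state_decoded_subset: "state_decoded n m x \<subseteq> {1..n}"
  by (auto simp: state_decoded_def sic_decoded_def)

text \<open>An active user has exactly one last active slot, and an inactive one has none, in which
  case the unspecified \<open>Max\<close> of the empty set is multiplied by 0. The right-hand side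
  reduces expectations to probabilities of product events.\<close>

lemma weighted_last_active:
  fixes w :: "nat \<Rightarrow> real"
  shows "of_bool (active_in m x i) * w (last_active m x i)
    = (\<Sum>j=1..m. w j * of_bool (x (i, j) \<noteq> {} \<and> (\<forall>j'\<in>{j<..m}. x (i, j') = {})))"
proof (cases "active_in m x i")
  case True
  define T where "T = {j \<in> {1..m}. x (i, j) \<noteq> {}}"
  have T: "finite T" "T \<noteq> {}" using True by (auto simp: T_def active_in_def)
  have "(x (i, j) \<noteq> {} \<and> (\<forall>j'\<in>{j<..m}. x (i, j') = {})) \<longleftrightarrow> j = Max T" if "j \<in> {1..m}" for j
  proof
    assume *: "x (i, j) \<noteq> {} \<and> (\<forall>j'\<in>{j<..m}. x (i, j') = {})"
    then have "y \<le> j" if "y \<in> T" for y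
      using that by (force simp: T_def not_le[symmetric])
    moreover have "j \<in> T" using * \<open>j \<in> {1..m}\<close> by (simp add: T_def)
    ultimately show "j = Max T"
      using Max_eqI[OF T(1), of j] by simp
  next
    assume j: "j = Max T"
    have "j \<in> T" using Max_in[OF T] j by simp
    moreover have "j' \<notin> T" if "j < j'" for j'
      using Max_ge[OF T(1), of j'] j that by auto
    ultimately show "x (i, j) \<noteq> {} \<and> (\<forall>j'\<in>{j<..m}. x (i, j') = {})"
      by (auto simp: T_def)
  qed
  then have "(\<Sum>j=1..m. w j * of_bool (x (i, j) \<noteq> {} \<and> (\<forall>j'\<in>{j<..m}. x (i, j') = {})))
      = (\<Sum>j=1..m. if j = Max T then w j else 0)"
    by (intro sum.cong) auto
  also have "\<dots> = w (Max T)"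
    using Max_in[OF T] by (simp add: T_def)
  finally show ?thesis using True by (simp add: last_active_def T_def)
qed (auto simp: active_in_def intro!: sum.neutral)

text \<open>The term p (1 - p)^(m - j) is the probability that slot j is the last active one of a
  frame, and 2 m + 1 - j is the age on reception of an update from that slot. The two sums are the
  activity probability and the unnormalised mean age.\<close>

lemma geometric_age_sum:
  fixes p :: real
  assumes "p \<noteq> 0"
  shows "(\<Sum>j=1..m. p * (1 - p) ^ (m - j)) = 1 - (1 - p) ^ m"
    and "(\<Sum>j=1..m. (real (2 * m + 1) - real j) * (p * (1 - p) ^ (m - j)))
      = (real m + 1 / p) * (1 - (1 - p) ^ m) - real m * (1 - p) ^ m"
proof -
  have rev: "(\<Sum>j=1..m. h (m - j)) = (\<Sum>k<m. h k)" for h :: "nat \<Rightarrow> real"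
    by (rule sum.reindex_bij_witness[of _ "\<lambda>k. m - k" "\<lambda>j. m - j"]) auto
  show geo: "(\<Sum>j=1..m. p * (1 - p) ^ (m - j)) = 1 - (1 - p) ^ m"
    unfolding rev[of "\<lambda>k. p * (1 - p) ^ k"]
    by (induction m) (auto simp: algebra_simps)
  have "(\<Sum>j=1..m. (real (2 * m + 1) - real j) * (p * (1 - p) ^ (m - j)))
      = (\<Sum>j=1..m. (real (m + 1) + real (m - j)) * (p * (1 - p) ^ (m - j)))"
    by (intro sum.cong) (auto simp: of_nat_diff)
  also have "\<dots> = (\<Sum>k<m. (real (m + 1) + real k) * (p * (1 - p) ^ k))"
    by (rule rev)
  also have "\<dots> = real (m + 1) * (\<Sum>k<m. p * (1 - p) ^ k) + (\<Sum>k<m. real k * (p * (1 - p) ^ k))"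
    by (simp add: distrib_right sum.distrib sum_distrib_left)
  also have "(\<Sum>k<m. real k * (p * (1 - p) ^ k)) = ((1 - p) * (1 - (1 - p) ^ m) - p * real m * (1 - p) ^ m) / p"
    using assms by (induction m) (auto simp: field_simps)
  also have "(\<Sum>k<m. p * (1 - p) ^ k) = 1 - (1 - p) ^ m"
    using geo rev[of "\<lambda>k. p * (1 - p) ^ k"] by simp
  finally show "(\<Sum>j=1..m. (real (2 * m + 1) - real j) * (p * (1 - p) ^ (m - j)))
      = (real m + 1 / p) * (1 - (1 - p) ^ m) - real m * (1 - p) ^ m"
    using assms by (simp add: field_simps)
qed

text \<open>\<open>pmf_of_set\<close> is specified only on nonempty finite sets; l <= L <= m ensures
  that {1..m} has a subset of size l.\<close>

lemma set_pmf_placement: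
  assumes "set_pmf \<Lambda> \<subseteq> {1..L}" "L \<le> m" "T \<in> set_pmf (placement_pmf m \<Lambda>)"
  shows "T \<subseteq> {1..m}"
proof -
  from assms(3) obtain l where l: "l \<in> set_pmf \<Lambda>"
    and T: "T \<in> set_pmf (pmf_of_set {T. T \<subseteq> {1..m} \<and> card T = l})"
    by (auto simp: placement_pmf_def)
  have "l \<le> card {1..m}" using l assms by auto
  then obtain U where "U \<subseteq> {1..m}" "card U = l"
    using obtain_subset_with_card_n by blast
  then have "{T. T \<subseteq> {1..m} \<and> card T = l} \<noteq> {}" by blast
  moreover have "finite {T. T \<subseteq> {1..m} \<and> card T = l}" by simp
  ultimately show ?thesis using T by simp
qed

text \<open>The affine recursion starts at the end of frame 1 but the time average at time 0; the
  extra term and the factor K / (K + 1) vanish in the limit.\<close>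

lemma average_shift:
  fixes u :: "nat \<Rightarrow> real"
  assumes "(\<lambda>K. (\<Sum>k<K. u (Suc k)) / real K) \<longlonglongrightarrow> y"
  shows "(\<lambda>K. (\<Sum>k<K. u k) / real K) \<longlonglongrightarrow> y"
proof (rule LIMSEQ_imp_Suc)
  have "(\<lambda>K. u 0 / real (Suc K) + (\<Sum>k<K. u (Suc k)) / real K * (real K / real (Suc K)))
      \<longlonglongrightarrow> 0 + y * 1"
    by (intro tendsto_add tendsto_mult assms LIMSEQ_n_over_Suc_n LIMSEQ_Suc[OF lim_const_over_n])
  moreover have "u 0 / real (Suc K) + (\<Sum>k<K. u (Suc k)) / real K * (real K / real (Suc K))
      = (\<Sum>k<Suc K. u k) / real (Suc K)" for K
    unfolding sum.lessThan_Suc_shift by (cases "K = 0") (auto simp: add_divide_distrib)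
  ultimately show "(\<lambda>K. (\<Sum>k<Suc K. u k) / real (Suc K)) \<longlonglongrightarrow> y"
    by simp
qed

section \<open>The law of a frame\<close>

context irsa
begin

text \<open>
  Activities and placements are encoded in the common type \<^typ>\<open>nat set\<close>, as \<^const>\<open>indep_vars\<close> and its
  product spaces need; intersecting with \<open>{1..m}\<close>, which changes nothing almost surely, makes the range finite.
  State \<open>k\<close> belongs to frame \<open>k + 2\<close>, as nothing is transmitted in frame 1.
\<close>

definition atom :: "(nat \<times> nat) + (nat \<times> nat) \<Rightarrow> 'w \<Rightarrow> nat set" where
  "atom x \<omega> = (case x of Inl (i, s) \<Rightarrow> if A \<omega> i s then {0} else {} | Inr (i, f) \<Rightarrow> C \<omega> i f \<inter> {1..m})"

text \<open>Slot k * m + j lies in frame k + 1, where the updates sent in frame k + 2 are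
  generated.\<close>

definition atom_index :: "nat \<Rightarrow> nat \<times> nat \<Rightarrow> (nat \<times> nat) + (nat \<times> nat)" where
  "atom_index k z = (case z of (i, j) \<Rightarrow> if j = 0 then Inr (i, k + 2) else Inl (i, k * m + j))"

definition frame_state :: "nat \<Rightarrow> 'w \<Rightarrow> nat \<times> nat \<Rightarrow> nat set" where
  "frame_state k \<omega> = restrict (\<lambda>z. atom (atom_index k z) \<omega>) ({1..n} \<times> {0..m})"

abbreviation atoms :: "((nat \<times> nat) + (nat \<times> nat)) set" where
  "atoms \<equiv> ({1..n} \<times> {1..}) <+> ({1..n} \<times> {1..})"
abbreviation "state_values \<equiv> Pow {0..m}"
abbreviation "state_space \<equiv> PiE ({1..n} \<times> {0..m}) (\<lambda>_. state_values)"

lemma random_activity: "i \<in> {1..n} \<Longrightarrow> s \<ge> 1 \<Longrightarrow> random_variable (count_space UNIV) (\<lambda>\<omega>. A \<omega> i s)"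
  and random_placement: "i \<in> {1..n} \<Longrightarrow> s \<ge> 1 \<Longrightarrow> random_variable (count_space UNIV) (\<lambda>\<omega>. C \<omega> i s)"
proof -
  assume i: "i \<in> {1..n}" "s \<ge> 1"
  have sub: "(case x of
        Inl (i, s) \<Rightarrow> {(\<lambda>\<omega>. A \<omega> i s) -` B \<inter> space M | B. B \<in> sets (count_space UNIV)}
      | Inr (i, f) \<Rightarrow> {(\<lambda>\<omega>. C \<omega> i f) -` B \<inter> space M | B. B \<in> sets (count_space UNIV)}) \<subseteq> events"
    if "x \<in> atoms" for x
    using indep that unfolding indep_sets_def by blast
  have "Inl (i, s) \<in> atoms" "Inr (i, s) \<in> atoms"
    using i by auto
  note sub = sub[OF this(1)] sub[OF this(2)]
  show "random_variable (count_space UNIV) (\<lambda>\<omega>. A \<omega> i s)"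
    using sub(1) by (intro measurableI) auto
  show "random_variable (count_space UNIV) (\<lambda>\<omega>. C \<omega> i s)"
    using sub(2) by (intro measurableI) auto
qed

text \<open>Each atom is a function of one activity or one placement, so its sigma-algebra is
  contained in the corresponding one of the independence assumption.\<close>

lemma indep_atoms: "indep_vars (\<lambda>_. count_space state_values) atom atoms"
  unfolding indep_vars_def2
proof (intro conjI ballI)
  fix x assume x: "x \<in> atoms"
  show "random_variable (count_space state_values) (atom x)"
  proof (cases x)
    case (Inl y)
    then obtain i s where [simp]: "x = Inl (i, s)" and "i \<in> {1..n}" "s \<ge> 1" using x by (cases y) auto
    have "(\<lambda>\<omega>. if A \<omega> i s then {0} else {}) \<in> measurable M (count_space state_values)"
      by (rule measurable_compose[OF random_activity[OF \<open>i \<in> {1..n}\<close> \<open>s \<ge> 1\<close>],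
            of "\<lambda>b. if b then {0} else {}"]) auto
    then show ?thesis by (simp add: atom_def[abs_def])
  next
    case (Inr y)
    then obtain i s where [simp]: "x = Inr (i, s)" and "i \<in> {1..n}" "s \<ge> 1" using x by (cases y) auto
    have "(\<lambda>\<omega>. C \<omega> i s \<inter> {1..m}) \<in> measurable M (count_space state_values)"
      by (rule measurable_compose[OF random_placement[OF \<open>i \<in> {1..n}\<close> \<open>s \<ge> 1\<close>], of "\<lambda>T. T \<inter> {1..m}"])
        auto
    then show ?thesis by (simp add: atom_def[abs_def])
  qed
next
  show "indep_sets (\<lambda>x. {atom x -` B \<inter> space M | B. B \<in> sets (count_space state_values)}) atoms"
  proof (rule indep_sets_mono_sets[OF indep])
    fix x assume "x \<in> atoms"
    show "{atom x -` B \<inter> space M |B. B \<in> sets (count_space state_values)}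
        \<subseteq> (case x of
            Inl (i, s) \<Rightarrow> {(\<lambda>\<omega>. A \<omega> i s) -` B \<inter> space M | B. B \<in> sets (count_space UNIV)}
          | Inr (i, f) \<Rightarrow> {(\<lambda>\<omega>. C \<omega> i f) -` B \<inter> space M | B. B \<in> sets (count_space UNIV)})"
    proof
      fix E assume "E \<in> {atom x -` B \<inter> space M |B. B \<in> sets (count_space state_values)}"
      then obtain B where E: "E = atom x -` B \<inter> space M" by blast
      show "E \<in> (case x of
            Inl (i, s) \<Rightarrow> {(\<lambda>\<omega>. A \<omega> i s) -` B \<inter> space M | B. B \<in> sets (count_space UNIV)}
          | Inr (i, f) \<Rightarrow> {(\<lambda>\<omega>. C \<omega> i f) -` B \<inter> space M | B. B \<in> sets (count_space UNIV)})"
      proof (cases x)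
        case (Inl y)
        obtain i s where y: "y = (i, s)" by (cases y)
        have "E = (\<lambda>\<omega>. A \<omega> i s) -` {b. (if b then {0} else {}) \<in> B} \<inter> space M"
          by (auto simp: E atom_def Inl y)
        then show ?thesis
          unfolding Inl y sum.case prod.case by (intro CollectI exI conjI, assumption) simp
      next
        case (Inr y)
        obtain i s where y: "y = (i, s)" by (cases y)
        have "E = (\<lambda>\<omega>. C \<omega> i s) -` {T. T \<inter> {1..m} \<in> B} \<inter> space M"
          by (auto simp: E atom_def Inr y)
        then show ?thesis
          unfolding Inr y sum.case prod.case by (intro CollectI exI conjI, assumption) simp
      qed
    qed
  qed
qed

text \<open>The right-hand sides mention neither user nor time: the law of an atom depends only on
  its kind.\<close>

lemma distr_atom:
  assumes "i \<in> {1..n}" "s \<ge> 1"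
  shows "distr M (count_space state_values) (atom (Inl (i, s)))
      = distr (measure_pmf (bernoulli_pmf \<pi>\<^sub>a)) (count_space state_values) (\<lambda>b. if b then {0} else {})"
    and "distr M (count_space state_values) (atom (Inr (i, s)))
      = distr (measure_pmf (placement_pmf m \<Lambda>)) (count_space state_values) (\<lambda>T. T \<inter> {1..m})"
  unfolding activity_distr[OF assms, symmetric] placement_distr[OF assms, symmetric]
  using random_activity[OF assms] random_placement[OF assms]
  by (subst distr_distr; auto simp: atom_def[abs_def] comp_def)+

lemma atom_index_bounds: "z \<in> {1..n} \<times> {0..m} \<Longrightarrow> atom_index k z \<in> atoms"
  by (auto simp: atom_index_def)

text \<open>For 1 <= j <= m the quotient of k * m + j - 1 by m recovers k, and a placement records
  its frame. Distinct states therefore read disjoint sets of atoms.\<close>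

lemma atom_index_inject:
  assumes "z \<in> {1..n} \<times> {0..m}" "z' \<in> {1..n} \<times> {0..m}" "atom_index k z = atom_index k' z'"
  shows "k = k' \<and> z = z'"
proof -
  obtain i j i' j' where z: "z = (i, j)" "z' = (i', j')" by (cases z; cases z')
  show ?thesis
  proof (cases "j = 0 \<or> j' = 0")
    case True
    then show ?thesis using assms(3) by (auto simp: atom_index_def z split: if_splits)
  next
    case False
    then have *: "i = i'" "k * m + j = k' * m + j'" "1 \<le> j" "j \<le> m" "1 \<le> j'" "j' \<le> m"
      using assms by (auto simp: atom_index_def z)
    have "k = (k * m + j - 1) div m" "k' = (k' * m + j' - 1) div m"
      using *(3-6) by (auto simp: div_nat_eqI algebra_simps intro!: div_nat_eqI[symmetric])
    then have "k = k'" using *(2) by simp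
    then show ?thesis using * z by simp
  qed
qed

text \<open>Activity in a frame matters only for the next frame, and a placement only for its own,
  so the states are built from disjoint blocks of independent atoms.\<close>

lemma indep_frame_states: "indep_vars (\<lambda>_. count_space state_space) frame_state UNIV"
proof -
  have disj: "disjoint_family_on (\<lambda>k. atom_index k ` ({1..n} \<times> {0..m})) UNIV"
    unfolding disjoint_family_on_def using atom_index_inject by blast
  have "indep_vars (\<lambda>k. PiM (atom_index k ` ({1..n} \<times> {0..m})) (\<lambda>_. count_space state_values))
      (\<lambda>k \<omega>. restrict (\<lambda>x. atom x \<omega>) (atom_index k ` ({1..n} \<times> {0..m}))) UNIV"
    using atom_index_bounds by (intro indep_vars_restrict[OF indep_atoms _ disj]) blast
  then have "indep_vars (\<lambda>_. count_space state_space)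
      (\<lambda>k \<omega>. restrict (\<lambda>z. restrict (\<lambda>x. atom x \<omega>) (atom_index k ` ({1..n} \<times> {0..m})) (atom_index k z))
        ({1..n} \<times> {0..m})) UNIV"
    by (rule indep_vars_compose2)
      (intro measurable_restrict_count_space measurable_component_singleton; simp)
  also have "(\<lambda>k \<omega>. restrict (\<lambda>z. restrict (\<lambda>x. atom x \<omega>) (atom_index k ` ({1..n} \<times> {0..m})) (atom_index k z))
        ({1..n} \<times> {0..m})) = frame_state"
    by (intro ext) (auto simp: frame_state_def restrict_def)
  finally show ?thesis .
qed

lemma AE_placement: "AE \<omega> in M. \<forall>i\<in>{1..n}. \<forall>f\<in>{1..}. C \<omega> i f \<subseteq> {1..m}"
proof -
  have "AE \<omega> in M. C \<omega> i f \<subseteq> {1..m}" if "i \<in> {1..n}" "f \<in> {1..}" for i f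
  proof -
    have f: "f \<ge> 1" using that by simp
    have "AE T in distr M (count_space UNIV) (\<lambda>\<omega>. C \<omega> i f). T \<subseteq> {1..m}"
      unfolding placement_distr[OF that(1) f] AE_measure_pmf_iff
      using set_pmf_placement[OF degree_support L_le_m] by auto
    then show ?thesis
      using random_placement[OF that(1) f] by (subst (asm) AE_distr_iff) auto
  qed
  then show ?thesis
    by (intro AE_ball_countable'[of "{1..n}"] AE_ball_countable'[of "{1..}"]) auto
qed

lemma frame_slots_Suc: "frame_slots m (Suc k) = (\<lambda>j. k * m + j) ` {1..m}"
  unfolding frame_slots_def by (simp add: add.commute)

lemma decoded_frame_state:
  assumes "\<forall>i\<in>{1..n}. \<forall>f\<in>{1..}. C \<omega> i f \<subseteq> {1..m}"
  shows "decoded n m (A \<omega>) (C \<omega>) (k + 2) = state_decoded n m (frame_state k \<omega>)"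
proof -
  have "(\<exists>s\<in>frame_slots m (k + 2 - 1). A \<omega> i s) \<longleftrightarrow> (\<exists>j\<in>{1..m}. A \<omega> i (k * m + j))" for i
    by (simp add: frame_slots_Suc del: image_add_atLeastAtMost)
  then have "transmitters n m (A \<omega>) (k + 2) = {i \<in> {1..n}. active_in m (frame_state k \<omega>) i}"
    by (auto simp: transmitters_def active_in_def frame_state_def atom_index_def atom_def)
  then show ?thesis
    unfolding decoded_def state_decoded_def
    using assms
    by (auto simp: frame_state_def atom_index_def atom_def Int_absorb2 intro!: sic_decoded_cong)
qed

text \<open>A decoded user was active, so the maximum is over a nonempty set and commutes with the
  shift by k * m. The final -1 is there because slot s begins at time s - 1.\<close>

lemma time_stamp_frame_state:
  assumes "i \<in> state_decoded n m (frame_state k \<omega>)"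
  shows "time_stamp m (A \<omega>) i (k + 2) = real (k * m) + real (last_active m (frame_state k \<omega>) i) - 1"
proof -
  define T where "T = {j \<in> {1..m}. frame_state k \<omega> (i, j) \<noteq> {}}"
  have i: "i \<in> {1..n}" "active_in m (frame_state k \<omega>) i"
    using assms by (auto simp: state_decoded_def sic_decoded_def)
  then have T: "finite T" "T \<noteq> {}" by (auto simp: T_def active_in_def)
  have "{s \<in> frame_slots m (k + 2 - 1). A \<omega> i s} = (\<lambda>j. k * m + j) ` T"
  proof -
    have T_A: "T = {j \<in> {1..m}. A \<omega> i (k * m + j)}"
      using i by (auto simp: T_def frame_state_def atom_index_def atom_def)
    have slots: "frame_slots m (k + 2 - 1) = (\<lambda>j. k * m + j) ` {1..m}"
      using frame_slots_Suc[of k] by simp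
    show ?thesis unfolding T_A slots by blast
  qed
  moreover have "Max ((\<lambda>j. k * m + j) ` T) = k * m + Max T"
    using mono_Max_commute[OF _ T, of "\<lambda>j. k * m + j"] by (simp add: mono_def)
  ultimately show ?thesis
    by (simp add: time_stamp_def last_active_def T_def)
qed

section \<open>Exchangeability of users, stationarity of frames and the throughput\<close>

lemma distr_atom_index:
  assumes "i \<in> {1..n}" "i' \<in> {1..n}" "j \<in> {0..m}"
  shows "distr M (count_space state_values) (atom (atom_index k (i, j)))
    = distr M (count_space state_values) (atom (atom_index k' (i', j)))"
proof (cases "j = 0")
  case True
  have "k + 2 \<ge> 1" "k' + 2 \<ge> 1" by simp_all
  then show ?thesis
    using distr_atom(2)[OF assms(1), of "k + 2"] distr_atom(2)[OF assms(2), of "k' + 2"] True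
    by (simp only: atom_index_def prod.case simp_thms if_True)
next
  case False
  then have "k * m + j \<ge> 1" "k' * m + j \<ge> 1" by simp_all
  then show ?thesis
    using distr_atom(1)[OF assms(1), of "k * m + j"] distr_atom(1)[OF assms(2), of "k' * m + j"] False
    by (simp only: atom_index_def prod.case simp_thms if_False)
qed

text \<open>Renaming users and changing the frame both preserve independence and marginals, hence
  the law of the state.\<close>

lemma expectation_relabel_users:
  fixes F :: "(nat \<times> nat \<Rightarrow> nat set) \<Rightarrow> real"
  assumes \<sigma>: "inj_on \<sigma> {1..n}" "\<sigma> ` {1..n} \<subseteq> {1..n}"
  shows "expectation (\<lambda>\<omega>. F (restrict (\<lambda>(i, j). frame_state k \<omega> (\<sigma> i, j)) ({1..n} \<times> {0..m})))
    = expectation (\<lambda>\<omega>. F (frame_state k' \<omega>))"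
proof -
  define J where "J = {1..n} \<times> {0..m}"
  have J: "finite J" "J \<noteq> {}" using n_ge_1 by (auto simp: J_def)
  have ind: "indep_vars (\<lambda>_. count_space state_values) (\<lambda>z. atom (atom_index l z)) J" for l
    using atom_index_inject[of _ _ l l] atom_index_bounds
    by (intro indep_vars_reindex[OF indep_atoms]) (auto simp: inj_on_def J_def)
  have ind_\<sigma>: "indep_vars (\<lambda>_. count_space state_values)
      (\<lambda>z. atom (atom_index k (apfst \<sigma> z))) J"
  proof (rule indep_vars_reindex[OF ind])
    show "inj_on (apfst \<sigma>) J"
      by (rule inj_onI) (use inj_onD[OF \<sigma>(1)] in \<open>auto simp: J_def\<close>)
    show "apfst \<sigma> ` J \<subseteq> J"
      using \<sigma>(2) by (auto simp: J_def)
  qed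
  have "expectation (\<lambda>\<omega>. F (restrict (\<lambda>z. atom (atom_index k (apfst \<sigma> z)) \<omega>) J))
      = expectation (\<lambda>\<omega>. F (restrict (\<lambda>z. atom (atom_index k' z) \<omega>) J))"
    using \<sigma> by (intro expectation_restrict_eq[OF ind_\<sigma> ind _ J])
      (auto simp: J_def image_subset_iff intro!: distr_atom_index)
  moreover have "restrict (\<lambda>z. atom (atom_index k (apfst \<sigma> z)) \<omega>) J
      = restrict (\<lambda>(i, j). frame_state k \<omega> (\<sigma> i, j)) J" for \<omega>
    using \<sigma> by (intro restrict_ext) (auto simp: J_def frame_state_def image_subset_iff)
  ultimately show ?thesis by (simp add: J_def frame_state_def)
qed

text \<open>User 1 and state 0 are representatives. The probability is not conditioned on activity,
  so it equals m S / n.\<close>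

definition decoding_prob :: real where
  "decoding_prob = expectation (\<lambda>\<omega>. of_bool (1 \<in> state_decoded n m (frame_state 0 \<omega>)))"

text \<open>Swapping users 1 and i preserves the law of the state and turns decoding of 1 into
  decoding of i; as the swap is its own inverse, \<open>sic_decoded_relabel\<close> gives both
  directions.\<close>

lemma expectation_decoded:
  assumes i: "i \<in> {1..n}"
  shows "expectation (\<lambda>\<omega>. of_bool (i \<in> state_decoded n m (frame_state k \<omega>))) = decoding_prob"
proof -
  define \<sigma> where "\<sigma> = Transposition.transpose 1 i"
  define J where "J = {1..n} \<times> {0..m}"
  have \<sigma>_inj: "inj_on \<sigma> U" for U
    by (rule inj_on_inverseI[of _ \<sigma>]) (simp add: \<sigma>_def)
  have \<sigma>: "\<sigma> ` {1..n} = {1..n}" "\<sigma> (\<sigma> l) = l" "\<sigma> i = 1" "\<sigma> 1 = i" for l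
    using i n_ge_1 by (auto simp: \<sigma>_def)
  define x' where "x' x = restrict (\<lambda>(l, j). x (\<sigma> l, j)) J" for x :: "nat \<times> nat \<Rightarrow> nat set"
  have "i \<in> state_decoded n m (x' x) \<longleftrightarrow> 1 \<in> state_decoded n m x" for x
  proof -
    have x': "x' x (l, j) = x (\<sigma> l, j)" if "l \<in> {1..n}" "j \<le> m" for l j
      using that by (simp add: x'_def J_def)
    then have act: "active_in m (x' x) l \<longleftrightarrow> active_in m x (\<sigma> l)" if "l \<in> {1..n}" for l
      using that by (simp add: active_in_def)
    have \<sigma>_mem: "\<sigma> l \<in> {1..n} \<longleftrightarrow> l \<in> {1..n}" for l
      using \<sigma>(1,2) by (metis imageI)
    define U U' where "U = {l \<in> {1..n}. active_in m x l}"
      and "U' = {l \<in> {1..n}. active_in m (x' x) l}"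
    have "l \<in> U' \<longleftrightarrow> \<sigma> l \<in> U" for l
      using act \<sigma>_mem unfolding U_def U'_def by blast
    then have UU': "\<sigma> ` U' = U" "\<sigma> ` U = U'"
      using \<sigma>(2) by (auto simp: image_iff) metis+
    have r: "x (\<sigma> l, 0) = x' x (l, 0)" if "l \<in> U'" for l
      using that x' by (simp add: U'_def)
    have r': "x' x (\<sigma> l, 0) = x (l, 0)" if "l \<in> U" for l
      using that x'[of "\<sigma> l" 0] \<sigma>(2) \<sigma>_mem[of l] by (simp add: U_def)
    show ?thesis
      using sic_decoded_relabel[of \<sigma> U' "\<lambda>l. x (l, 0)" "\<lambda>l. x' x (l, 0)" i]
        sic_decoded_relabel[of \<sigma> U "\<lambda>l. x' x (l, 0)" "\<lambda>l. x (l, 0)" 1] \<sigma>_inj \<sigma> r r' UU'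
      unfolding state_decoded_def U_def[symmetric] U'_def[symmetric] by auto
  qed
  then have "decoding_prob = expectation (\<lambda>\<omega>. of_bool (i \<in> state_decoded n m (x' (frame_state 0 \<omega>))))"
    by (simp add: decoding_prob_def)
  also have "\<dots> = expectation (\<lambda>\<omega>. of_bool (i \<in> state_decoded n m (frame_state k \<omega>)))"
    unfolding x'_def J_def
    by (rule expectation_relabel_users[OF \<sigma>_inj, of "\<lambda>x. of_bool (i \<in> state_decoded n m x)"]) (simp only: \<sigma> order.refl)
  finally show ?thesis by simp
qed

lemma integrable_frame_state:
  fixes F :: "(nat \<times> nat \<Rightarrow> nat set) \<Rightarrow> real"
  shows "integrable M (\<lambda>\<omega>. F (frame_state k \<omega>))"
  using indep_frame_states
  by (intro integrable_finite_range[of _ state_space]) (auto simp: indep_vars_def intro!: finite_PiE)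

text \<open>The number of decoded users is a sum of n indicators with equal means.\<close>

lemma throughput_eq:
  assumes "f \<ge> 2" "throughput M n m A C f > 0"
  shows "throughput M n m A C f = real n * decoding_prob / real m"
proof -
  define k where "k = f - 2"
  have f: "f = k + 2" using assms(1) by (simp add: k_def)
  \<comment> \<open>A positive Bochner integral is not the default value for non-integrable functions; this gives
    measurability without examining \<^const>\<open>decoded\<close> on placements outside \<open>{1..m}\<close>.\<close>
  have "integrable M (\<lambda>\<omega>. real (card (decoded n m (A \<omega>) (C \<omega>) f)))"
    using assms(2) not_integrable_integral_eq
    by (fastforce simp: throughput_def)
  then have "(\<integral>\<omega>. real (card (decoded n m (A \<omega>) (C \<omega>) f)) \<partial>M)
      = expectation (\<lambda>\<omega>. real (card (state_decoded n m (frame_state k \<omega>))))"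
    using AE_placement integrable_frame_state[of "\<lambda>x. real (card (state_decoded n m x))" k]
    by (intro integral_cong_AE) (auto simp only: f decoded_frame_state elim!: eventually_mono)
  also have "\<dots> = expectation (\<lambda>\<omega>. \<Sum>i=1..n. of_bool (i \<in> state_decoded n m (frame_state k \<omega>)))"
    using state_decoded_subset[of n m]
    by (simp add: Int_absorb1 sum.If_cases of_bool_def)
  also have "\<dots> = (\<Sum>i=1..n. expectation (\<lambda>\<omega>. of_bool (i \<in> state_decoded n m (frame_state k \<omega>))))"
    by (rule Bochner_Integration.integral_sum) (rule integrable_frame_state)
  also have "\<dots> = (\<Sum>i=1..n. decoding_prob)"
    by (intro sum.cong refl expectation_decoded)
  finally show ?thesis by (simp add: throughput_def)
qed

section \<open>Last active slot and mean age of a received update\<close>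

text \<open>Activity in slot j and silence in the m - j later slots of the frame are
  independent.\<close>

lemma prob_last_active:
  assumes i: "i \<in> {1..n}" and j: "j \<in> {1..m}"
  shows "expectation (\<lambda>\<omega>. of_bool (frame_state k \<omega> (i, j) \<noteq> {}
    \<and> (\<forall>j'\<in>{j<..m}. frame_state k \<omega> (i, j') = {}))) = \<pi>\<^sub>a * (1 - \<pi>\<^sub>a) ^ (m - j)"
proof -
  define X where "X j = atom (Inl (i, k * m + j))" for j
  define E where "E j' = (if j' = j then state_values - {{}} else {{}})" for j'
  have X: "indep_vars (\<lambda>_. count_space state_values) X {j..m}"
    unfolding X_def using i j
    by (intro indep_vars_reindex[OF indep_atoms]) (auto simp: inj_on_def)
  have "X j' -` E j' \<inter> space M = (\<lambda>\<omega>. A \<omega> i (k * m + j')) -` {j' = j} \<inter> space M" for j'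
  proof -
    have "X j' \<omega> \<in> E j' \<longleftrightarrow> A \<omega> i (k * m + j') = (j' = j)" for \<omega>
      by (simp add: X_def E_def atom_def)
    then show ?thesis by (simp add: vimage_def)
  qed
  moreover have "prob ((\<lambda>\<omega>. A \<omega> i (k * m + j')) -` {b} \<inter> space M) = pmf (bernoulli_pmf \<pi>\<^sub>a) b"
    if "j' \<in> {j..m}" for j' b
    using activity_distr[of i "k * m + j'"] measure_distr[OF random_activity, of i "k * m + j'" "{b}"] i j that
    by (simp add: measure_pmf_single)
  ultimately have "prob (X j' -` E j' \<inter> space M) = (if j' = j then \<pi>\<^sub>a else 1 - \<pi>\<^sub>a)" if "j' \<in> {j..m}" for j'
    using that act_prob by simp
  then have "prob (\<Inter>j'\<in>{j..m}. X j' -` E j' \<inter> space M) = (\<Prod>j'\<in>{j..m}. if j' = j then \<pi>\<^sub>a else 1 - \<pi>\<^sub>a)"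
    using j by (subst indep_varsD[OF X]) (auto simp: E_def)
  also have "\<dots> = \<pi>\<^sub>a * (1 - \<pi>\<^sub>a) ^ (m - j)"
    using j by (subst prod.atLeast_Suc_atMost) auto
  finally have prob: "prob (\<Inter>j'\<in>{j..m}. X j' -` E j' \<inter> space M) = \<pi>\<^sub>a * (1 - \<pi>\<^sub>a) ^ (m - j)" .
  have eq: "(\<Inter>j'\<in>{j..m}. X j' -` E j' \<inter> space M)
      = {\<omega> \<in> space M. frame_state k \<omega> (i, j) \<noteq> {} \<and> (\<forall>j'\<in>{j<..m}. frame_state k \<omega> (i, j') = {})}"
  proof -
    have st: "frame_state k \<omega> (i, j') = X j' \<omega>" if "j' \<in> {j..m}" for j' \<omega>
      using that i j by (simp add: frame_state_def X_def atom_index_def)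
    have "X j' \<omega> \<subseteq> {0}" for j' \<omega> by (simp add: X_def atom_def)
    then have E_iff: "X j' \<omega> \<in> E j' \<longleftrightarrow> (if j' = j then X j' \<omega> \<noteq> {} else X j' \<omega> = {})" for j' \<omega>
      by (fastforce simp: E_def)
    have split: "{j..m} = insert j {j<..m}" using j by auto
    have "(\<forall>j'\<in>{j..m}. X j' \<omega> \<in> E j') \<longleftrightarrow> X j \<omega> \<noteq> {} \<and> (\<forall>j'\<in>{j<..m}. X j' \<omega> = {})" for \<omega>
      unfolding E_iff split by auto
    then have "(\<forall>j'\<in>{j..m}. X j' \<omega> \<in> E j') \<longleftrightarrow>
        frame_state k \<omega> (i, j) \<noteq> {} \<and> (\<forall>j'\<in>{j<..m}. frame_state k \<omega> (i, j') = {})" for \<omega>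
      using j by (simp add: st)
    moreover have "(\<Inter>j'\<in>{j..m}. X j' -` E j' \<inter> space M) = {\<omega> \<in> space M. \<forall>j'\<in>{j..m}. X j' \<omega> \<in> E j'}"
      using j by auto
    ultimately show ?thesis by simp
  qed
  have "prob R = expectation (indicator R)" if "R \<subseteq> space M" for R
    using that by (simp add: Int_absorb2)
  from this[of "{\<omega> \<in> space M. frame_state k \<omega> (i, j) \<noteq> {}
      \<and> (\<forall>j'\<in>{j<..m}. frame_state k \<omega> (i, j') = {})}"] prob
  have "\<pi>\<^sub>a * (1 - \<pi>\<^sub>a) ^ (m - j) = expectation (indicator {\<omega> \<in> space M. frame_state k \<omega> (i, j) \<noteq> {}
      \<and> (\<forall>j'\<in>{j<..m}. frame_state k \<omega> (i, j') = {})})"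
    unfolding eq by (simp add: subset_eq)
  also have "\<dots> = expectation (\<lambda>\<omega>. of_bool (frame_state k \<omega> (i, j) \<noteq> {}
      \<and> (\<forall>j'\<in>{j<..m}. frame_state k \<omega> (i, j') = {})))"
    by (intro Bochner_Integration.integral_cong refl) (simp add: indicator_def)
  finally show ?thesis by (rule sym)
qed

text \<open>Once user i transmits, its decoding depends on its placement and on the other users, not
  on when it was active. The expectation splits into a factor for its activity and one for
  everything else; multiplying by the activity probability avoids a conditional expectation.\<close>

lemma expectation_decoded_weighted:
  fixes w :: "nat \<Rightarrow> real"
  assumes i: "i \<in> {1..n}"
  shows "expectation (\<lambda>\<omega>. of_bool (i \<in> state_decoded n m (frame_state k \<omega>))
        * w (last_active m (frame_state k \<omega>) i))
      * (1 - (1 - \<pi>\<^sub>a) ^ m)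
    = decoding_prob * (\<Sum>j=1..m. w j * (\<pi>\<^sub>a * (1 - \<pi>\<^sub>a) ^ (m - j)))"
proof -
  define J where "J = {1..n} \<times> {0..m}"
  \<comment> \<open>\<open>J1\<close> holds only the activities of user i; its placement, at index
    0, stays in \<open>J2\<close>.\<close>
  define J1 where "J1 = {i} \<times> {1..m}"
  define J2 where "J2 = J - J1"
  \<comment> \<open>\<open>D\<close> lets user i transmit regardless of its activity, which frees it
    from the coordinates in \<open>J1\<close>.\<close>
  define D :: "(nat \<times> nat \<Rightarrow> nat set) \<Rightarrow> real"
    where "D x = of_bool (i \<in> sic_decoded (\<lambda>l. x (l, 0)) (insert i {l \<in> {1..n} - {i}. active_in m x l}))" for x
  define V where "V w x = of_bool (active_in m x i) * w (last_active m x i)"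
    for w :: "nat \<Rightarrow> real" and x :: "nat \<times> nat \<Rightarrow> nat set"
  have J: "J1 \<subseteq> J" "J2 \<subseteq> J" "finite J1" "finite J2" "J1 \<inter> J2 = {}"
    using i by (auto simp: J_def J1_def J2_def)
  have ind: "indep_vars (\<lambda>_. count_space state_values) (\<lambda>z. atom (atom_index k z)) J"
    using atom_index_inject[of _ _ k k] atom_index_bounds
    by (intro indep_vars_reindex[OF indep_atoms]) (auto simp: inj_on_def J_def)
  have V_restrict: "V w (frame_state k \<omega>) = V w (restrict (\<lambda>z. atom (atom_index k z) \<omega>) J1)" for w \<omega>
  proof -
    have "frame_state k \<omega> (i, j) = restrict (\<lambda>z. atom (atom_index k z) \<omega>) J1 (i, j)" if "j \<in> {1..m}" for j
      using that i by (simp add: frame_state_def J1_def)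
    then show ?thesis
      by (simp add: V_def active_in_def last_active_def cong: conj_cong)
  qed
  have D_restrict: "D (frame_state k \<omega>) = D (restrict (\<lambda>z. atom (atom_index k z) \<omega>) J2)" for \<omega>
  proof -
    define x where "x = frame_state k \<omega>"
    define x' where "x' = restrict (\<lambda>z. atom (atom_index k z) \<omega>) J2"
    have xx': "x (l, j) = x' (l, j)" if "l \<in> {1..n}" "j \<in> {0..m}" "l \<noteq> i \<or> j = 0" for l j
      using that by (auto simp: x_def x'_def frame_state_def J2_def J_def J1_def)
    then have "active_in m x l = active_in m x' l" if "l \<in> {1..n} - {i}" for l
      using that by (simp add: active_in_def)
    then have "{l \<in> {1..n} - {i}. active_in m x l} = {l \<in> {1..n} - {i}. active_in m x' l}"
      by blast
    moreover have "sic_decoded (\<lambda>l. x (l, 0)) (insert i {l \<in> {1..n} - {i}. active_in m x' l})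
        = sic_decoded (\<lambda>l. x' (l, 0)) (insert i {l \<in> {1..n} - {i}. active_in m x' l})"
      using i xx' by (intro sic_decoded_cong) auto
    ultimately show ?thesis by (simp add: D_def flip: x_def x'_def)
  qed
  have dec: "of_bool (i \<in> state_decoded n m x) * w (last_active m x i) = V w x * D x" for x and w :: "nat \<Rightarrow> real"
  proof (cases "active_in m x i")
    case True
    then have "{l \<in> {1..n}. active_in m x l} = insert i {l \<in> {1..n} - {i}. active_in m x l}"
      using i by auto
    then show ?thesis using True by (simp add: state_decoded_def V_def D_def)
  qed (simp add: state_decoded_def sic_decoded_def V_def)
  have prod: "expectation (\<lambda>\<omega>. of_bool (i \<in> state_decoded n m (frame_state k \<omega>))
        * w (last_active m (frame_state k \<omega>) i))
      = expectation (\<lambda>\<omega>. V w (frame_state k \<omega>)) * expectation (\<lambda>\<omega>. D (frame_state k \<omega>))" for w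
    unfolding dec V_restrict D_restrict
    by (rule indep_vars_discrete_restrict[OF ind _ J(1) J(3) J(2) J(4) J(5)]) simp
  have V: "expectation (\<lambda>\<omega>. V w (frame_state k \<omega>)) = (\<Sum>j=1..m. w j * (\<pi>\<^sub>a * (1 - \<pi>\<^sub>a) ^ (m - j)))" for w
  proof -
    have "expectation (\<lambda>\<omega>. V w (frame_state k \<omega>)) = (\<Sum>j=1..m. expectation (\<lambda>\<omega>. w j * of_bool (frame_state k \<omega> (i, j) \<noteq> {}
        \<and> (\<forall>j'\<in>{j<..m}. frame_state k \<omega> (i, j') = {}))))"
      unfolding V_def weighted_last_active
      by (rule Bochner_Integration.integral_sum) (rule integrable_frame_state)
    also have "\<dots> = (\<Sum>j=1..m. w j * (\<pi>\<^sub>a * (1 - \<pi>\<^sub>a) ^ (m - j)))"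
    proof (intro sum.cong refl)
      fix j assume "j \<in> {1..m}"
      then show "expectation (\<lambda>\<omega>. w j * of_bool (frame_state k \<omega> (i, j) \<noteq> {}
        \<and> (\<forall>j'\<in>{j<..m}. frame_state k \<omega> (i, j') = {}))) = w j * (\<pi>\<^sub>a * (1 - \<pi>\<^sub>a) ^ (m - j))"
        by (subst integral_mult_right_zero, subst prob_last_active[OF i]) simp_all
    qed
    finally show ?thesis .
  qed
  have one: "(\<Sum>j=1..m. 1 * (\<pi>\<^sub>a * (1 - \<pi>\<^sub>a) ^ (m - j))) = 1 - (1 - \<pi>\<^sub>a) ^ m"
    using geometric_age_sum(1)[of \<pi>\<^sub>a m] act_prob by simp
  \<comment> \<open>The constant weight 1 expresses \<open>decoding_prob\<close> through the mean of
    \<open>D\<close>, which is thereby eliminated.\<close>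
  have "decoding_prob = (1 - (1 - \<pi>\<^sub>a) ^ m) * expectation (\<lambda>\<omega>. D (frame_state k \<omega>))"
    using prod[of "\<lambda>_. 1"] expectation_decoded[OF i, of k] unfolding V one by simp
  then show ?thesis
    unfolding prod V by simp
qed

text \<open>This is the mean age of an update at its reception, given that it is decoded.\<close>

definition mean_reception_age :: real where
  "mean_reception_age = real m + 1 / \<pi>\<^sub>a - real m * (1 - \<pi>\<^sub>a) ^ m / (1 - (1 - \<pi>\<^sub>a) ^ m)"

text \<open>The weight is the difference between the reception time (k + 2) m and the stamp k m + j
  - 1. Division by the activity probability is legitimate because \<open>\<pi>\<^sub>a\<close> > 0
  and m >= 1.\<close>

lemma expectation_age_at_reception:
  assumes i: "i \<in> {1..n}"
  shows "expectation (\<lambda>\<omega>. of_bool (i \<in> state_decoded n m (frame_state k \<omega>))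
      * (real (2 * m + 1) - real (last_active m (frame_state k \<omega>) i))) = decoding_prob * mean_reception_age"
    (is "?E = _")
proof -
  have "(1 - \<pi>\<^sub>a) ^ m \<le> 1 - \<pi>\<^sub>a"
    using power_decreasing[of 1 m "1 - \<pi>\<^sub>a"] act_prob m_ge_1 by simp
  then have c: "1 - (1 - \<pi>\<^sub>a) ^ m \<noteq> 0" using act_prob by simp
  have "?E * (1 - (1 - \<pi>\<^sub>a) ^ m)
      = decoding_prob * ((real m + 1 / \<pi>\<^sub>a) * (1 - (1 - \<pi>\<^sub>a) ^ m) - real m * (1 - \<pi>\<^sub>a) ^ m)"
    using expectation_decoded_weighted[OF i, of k "\<lambda>j. real (2 * m + 1) - real j"]
      geometric_age_sum(2)[of \<pi>\<^sub>a m] act_prob by simp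
  also have "\<dots> = decoding_prob * mean_reception_age * (1 - (1 - \<pi>\<^sub>a) ^ m)"
    using c by (simp add: mean_reception_age_def left_diff_distrib)
  finally show ?thesis using c by simp
qed

section \<open>Convergence of the average age of one user\<close>

text \<open>With p the decoding probability and R the mean reception age, the recursion has limit
  ((1 - p) m + p R) / p = m / p - m + R, and the slope within frames adds m / 2.\<close>

lemma AE_mean_age:
  assumes i: "i \<in> {1..n}" and p: "decoding_prob > 0"
  shows "AE \<omega> in M. (mean_age_upto n m y0 (A \<omega>) (C \<omega>) i
    \<longlongrightarrow> real m / decoding_prob - real m / 2 + mean_reception_age) at_top"
proof -
  define a :: "(nat \<times> nat \<Rightarrow> nat set) \<Rightarrow> real" where "a x = of_bool (i \<notin> state_decoded n m x)" for x
  define g :: "(nat \<times> nat \<Rightarrow> nat set) \<Rightarrow> real"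
    where "g x = a x * real m
      + of_bool (i \<in> state_decoded n m x) * (real (2 * m + 1) - real (last_active m x i))" for x
  \<comment> \<open>\<open>Y\<close> obeys the recursion on every path; where all placements lie in
    {1..m} it is the age at the end of frame k + 1, starting from m - y0 i at time m.\<close>
  define Y where "Y k \<omega> = rec_nat (real m - y0 i) (\<lambda>k u. a (frame_state k \<omega>) * u + g (frame_state k \<omega>)) k" for k \<omega>
  have a: "expectation (\<lambda>\<omega>. a (frame_state k \<omega>)) = 1 - decoding_prob" for k
  proof -
    have "a x = 1 - of_bool (i \<in> state_decoded n m x)" for x by (simp add: a_def)
    then show ?thesis
      using integrable_frame_state[of "\<lambda>x. of_bool (i \<in> state_decoded n m x)" k]
        expectation_decoded[OF i, of k] by (simp add: prob_space)
  qed
  have g: "expectation (\<lambda>\<omega>. g (frame_state k \<omega>)) = (1 - decoding_prob) * real m + decoding_prob * mean_reception_age" for k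
    unfolding g_def a[of k, symmetric] expectation_age_at_reception[OF i, of k, symmetric]
    by (subst Bochner_Integration.integral_add) (rule integrable_frame_state | simp)+
  have "AE \<omega> in M. (\<lambda>K. (\<Sum>k<K. Y k \<omega>) / real K)
      \<longlonglongrightarrow> ((1 - decoding_prob) * real m + decoding_prob * mean_reception_age) / (1 - (1 - decoding_prob))"
  proof (rule AE_average_of_recursion[where F = state_space and X = frame_state and a = a and g = g])
    show "Y 0 \<omega> = real m - y0 i" "Y (Suc k) \<omega> = a (frame_state k \<omega>) * Y k \<omega> + g (frame_state k \<omega>)" for k \<omega>
      by (simp_all add: Y_def)
    show "a x \<in> {0, 1}" for x
      by (simp add: a_def)
    show "finite state_space" by (intro finite_PiE) auto
    show "1 - decoding_prob < 1" using p by simp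
  qed (fact indep_frame_states a g)+
  also have "((1 - decoding_prob) * real m + decoding_prob * mean_reception_age) / (1 - (1 - decoding_prob))
      = real m / decoding_prob - real m + mean_reception_age"
    using p by (simp add: field_simps)
  finally have "AE \<omega> in M. (\<lambda>K. (\<Sum>k<K. Y k \<omega>) / real K) \<longlonglongrightarrow> real m / decoding_prob - real m + mean_reception_age" .
  with AE_placement show ?thesis
  proof eventually_elim
    case (elim \<omega>)
    define u where "u k = age n m y0 (A \<omega>) (C \<omega>) i (real k * real m)" for k
    have dec: "decoded n m (A \<omega>) (C \<omega>) (Suc (Suc k)) = state_decoded n m (frame_state k \<omega>)" for k
      using decoded_frame_state[OF elim(1), of k] by simp
    have stamp: "time_stamp m (A \<omega>) i (Suc (Suc k)) = real (k * m) + real (last_active m (frame_state k \<omega>) i) - 1"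
      if "i \<in> state_decoded n m (frame_state k \<omega>)" for k
      using time_stamp_frame_state[OF that] by simp
    have "u (Suc k) = Y k \<omega>" for k
    proof (induction k)
      case 0
      show ?case
        unfolding u_def age_frame_1[OF m_ge_1] by (simp add: Y_def)
    next
      case (Suc k)
      have "u (Suc (Suc k)) = (if i \<in> state_decoded n m (frame_state k \<omega>)
          then real (Suc (Suc k)) * real m - time_stamp m (A \<omega>) i (Suc (Suc k)) else u (Suc k) + real m)"
        unfolding u_def dec[symmetric] by (rule age_frame_Suc[OF m_ge_1]) simp
      also have "\<dots> = a (frame_state k \<omega>) * u (Suc k) + g (frame_state k \<omega>)"
        by (simp add: a_def g_def stamp algebra_simps)
      finally show ?case by (simp add: Suc Y_def)
    qed
    then have "(\<lambda>K. (\<Sum>k<K. u (Suc k)) / real K) \<longlonglongrightarrow> real m / decoding_prob - real m + mean_reception_age"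
      using elim(2) by simp
    then have avg: "(\<lambda>K. (\<Sum>k<K. u k) / real K) \<longlonglongrightarrow> real m / decoding_prob - real m + mean_reception_age"
      by (rule average_shift)
    have "((\<lambda>\<tau>. 1 / \<tau> * integral {0..\<tau>} (age n m y0 (A \<omega>) (C \<omega>) i))
        \<longlongrightarrow> real m / decoding_prob - real m + mean_reception_age + real m / 2) at_top"
    proof (rule mean_of_sawtooth[OF _ _ avg])
      show "0 < real m" using m_ge_1 by simp
    qed (unfold u_def, rule age_within_frame[OF m_ge_1])
    then show ?case
      by (simp add: mean_age_upto_def[abs_def] algebra_simps)
  qed
qed

end

theorem proposition1:
  fixes M :: "'w measure" and n m L f :: nat and \<pi>\<^sub>a S :: real and \<Lambda> :: "nat pmf"
    and A :: "'w \<Rightarrow> activity" and C :: "'w \<Rightarrow> placement" and y0 :: "nat \<Rightarrow> real"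
  assumes "irsa M n m L \<pi>\<^sub>a \<Lambda> A C"
    and "f \<ge> 2" and "S = throughput M n m A C f" and "S > 0"
  shows "AE \<omega> in M.
    (\<forall>i\<in>{1..n}. \<exists>l. (mean_age_upto n m y0 (A \<omega>) (C \<omega>) i \<longlongrightarrow> l) at_top) \<and>
    network_age n m y0 (A \<omega>) (C \<omega>) =
      real m / 2 + real n / S
        + (1 / \<pi>\<^sub>a - real m * (1 - \<pi>\<^sub>a) ^ m / (1 - (1 - \<pi>\<^sub>a) ^ m))"
proof -
  interpret irsa M n m L \<pi>\<^sub>a \<Lambda> A C by fact
  have S: "S = real n * decoding_prob / real m"
    using throughput_eq assms by simp
  have nm: "real n > 0" "real m > 0" using n_ge_1 m_ge_1 by auto
  have p: "decoding_prob > 0"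
    using \<open>S > 0\<close> nm unfolding S by (simp add: zero_less_divide_iff zero_less_mult_iff)
  have "AE \<omega> in M. \<forall>i\<in>{1..n}. (mean_age_upto n m y0 (A \<omega>) (C \<omega>) i
      \<longlongrightarrow> real m / decoding_prob - real m / 2 + mean_reception_age) at_top"
    using AE_mean_age[OF _ p] by (intro AE_finite_allI) auto
  then show ?thesis
  proof eventually_elim
    case (elim \<omega>)
    have "average_age n m y0 (A \<omega>) (C \<omega>) i = real m / decoding_prob - real m / 2 + mean_reception_age"
      if "i \<in> {1..n}" for i
      unfolding average_age_def using elim that by (intro tendsto_Lim) auto
    then have "network_age n m y0 (A \<omega>) (C \<omega>) = real m / decoding_prob - real m / 2 + mean_reception_age"
      using nm by (simp add: network_age_def)
    \<comment> \<open>The formula for \<open>S\<close> turns m / p into n / S, and the summand m of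
      \<open>mean_reception_age\<close> turns -m / 2 into m / 2.\<close>
    also have "\<dots> = real m / 2 + real n / S
        + (1 / \<pi>\<^sub>a - real m * (1 - \<pi>\<^sub>a) ^ m / (1 - (1 - \<pi>\<^sub>a) ^ m))"
      using nm by (simp add: mean_reception_age_def S)
    finally show ?case using elim by blast
  qed
qed

end
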